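(* Let $\Gamma$ be a non-elementary Gromov hyperbolic group acting properly, cocompactly and by isometries on a roughly geodesic, strongly hyperbolic metric space $(X,\rho)$ with parameter $\epsilon>0$. Fix $o\in X$, let $Z=\partial X$ with the metric $d(\xi,\eta)=\exp(-\epsilon\langle\xi,\eta\rangle_o)$, let $D$ be the Hausdorff dimension of $(Z,d)$ and $\nu$ the $D$-dimensional Hausdorff measure on $(Z,d)$, which is Ahlfors--David $D$-regular. Let $1<p<\infty$. Then $W^{\log,p}(Z)$ is compactly embedded in $L^p(Z,\nu)$, i.e. the inclusion $W^{\log,p}(Z)\to L^p(Z,\nu)$ is a compact operator.
   Context: Gromov product: $\langle x,y\rangle_o=\frac12(\rho(o,x)+\rho(o,y)-\rho(x,y))$. $(X,\rho)$ is roughly geodesic if there is $C_0\ge0$ such that for all $x,y\in X$ there is $\gamma:[a,b]\to X$ with $\gamma(a)=x$, $\gamma(b)=y$ and $|s-s'|-C_0\le\rho(\gamma(s),\gamma(s'))\le|s-s'|+C_0$ for all $s,s'\in[a,b]$. $(X,\rho)$ is strongly hyperbolic with parameter $\epsilon>0$ if $e^{-\epsilon\langle x,y\rangle_o}\le e^{-\epsilon\langle x,z\rangle_o}+e^{-\epsilon\langle z,y\rangle_o}$ for all $x,y,z,o\in X$; then the Gromov product extends continuously to $X\cup\partial X$ and $d$ above is a metric on $\partial X$. Ahlfors--David $D$-regular: $\nu(B(\xi,r))\asymp r^D$ for all $\xi\in Z$, $0\le r\le\operatorname{diam}(Z)$ (closed balls). $\mathcal{E}_{\log,p}(\phi)=\iint_{Z^2}\frac{|\phi(\xi)-\phi(\eta)|^p}{d^D(\xi,\eta)}\,\mathrm{d}\nu(\xi)\mathrm{d}\nu(\eta)$,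 and $W^{\log,p}(Z)=\{\phi\in L^p(Z,\nu):\mathcal{E}_{\log,p}(\phi)<\infty\}$ is the Banach space with norm $\|\phi|W^{\log,p}\|^p=\|\phi|L^p\|^p+\mathcal{E}_{\log,p}(\phi)$. *)

theory Defs
  imports
    "HOL-Analysis.Analysis"
    "HOL-Algebra.Group_Action"
    "HOL-Algebra.Elementary_Groups"
begin

section \<open>Hyperbolicity\<close>

definition gromov_product :: "('a \<Rightarrow> 'a \<Rightarrow> real) \<Rightarrow> 'a \<Rightarrow> 'a \<Rightarrow> 'a \<Rightarrow> real" where
  "gromov_product \<rho> w x y = (\<rho> w x + \<rho> w y - \<rho> x y) / 2"

definition gromov_hyperbolic :: "'a set \<Rightarrow> ('a \<Rightarrow> 'a \<Rightarrow> real) \<Rightarrow> bool" where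
  "gromov_hyperbolic M \<rho> \<longleftrightarrow>
     (\<exists>\<delta>\<ge>0. \<forall>w\<in>M. \<forall>x\<in>M. \<forall>y\<in>M. \<forall>z\<in>M.
        gromov_product \<rho> w x y
          \<ge> min (gromov_product \<rho> w x z) (gromov_product \<rho> w z y) - \<delta>)"

definition strongly_hyperbolic :: "'a set \<Rightarrow> ('a \<Rightarrow> 'a \<Rightarrow> real) \<Rightarrow> real \<Rightarrow> bool" where
  "strongly_hyperbolic M \<rho> \<epsilon> \<longleftrightarrow>
     \<epsilon> > 0 \<and>
     (\<forall>w\<in>M. \<forall>x\<in>M. \<forall>y\<in>M. \<forall>z\<in>M.
        exp (- \<epsilon> * gromov_product \<rho> w x y)
          \<le> exp (- \<epsilon> * gromov_product \<rho> w x z) + exp (- \<epsilon> * gromov_product \<rho> w z y))"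

definition roughly_geodesic :: "'a set \<Rightarrow> ('a \<Rightarrow> 'a \<Rightarrow> real) \<Rightarrow> bool" where
  "roughly_geodesic M \<rho> \<longleftrightarrow>
     (\<exists>C0\<ge>0. \<forall>x\<in>M. \<forall>y\<in>M. \<exists>(a::real) b \<gamma>.
        a \<le> b \<and> \<gamma> \<in> {a..b} \<rightarrow> M \<and> \<gamma> a = x \<and> \<gamma> b = y \<and>
        (\<forall>s\<in>{a..b}. \<forall>s'\<in>{a..b}.
           \<bar>s - s'\<bar> - C0 \<le> \<rho> (\<gamma> s) (\<gamma> s') \<and> \<rho> (\<gamma> s) (\<gamma> s') \<le> \<bar>s - s'\<bar> + C0))"

section \<open>Hyperbolic groups and their actions\<close>

definition word_length :: "('g, 'm) monoid_scheme \<Rightarrow> 'g set \<Rightarrow> 'g \<Rightarrow> nat" where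
  "word_length G S g =
     (LEAST n. \<exists>ws. length ws = n \<and> set ws \<subseteq> S \<union> (\<lambda>s. inv\<^bsub>G\<^esub> s) ` S \<and>
                    foldr (\<lambda>a b. a \<otimes>\<^bsub>G\<^esub> b) ws \<one>\<^bsub>G\<^esub> = g)"

definition word_metric :: "('g, 'm) monoid_scheme \<Rightarrow> 'g set \<Rightarrow> 'g \<Rightarrow> 'g \<Rightarrow> real" where
  "word_metric G S g h = real (word_length G S (inv\<^bsub>G\<^esub> g \<otimes>\<^bsub>G\<^esub> h))"

definition hyperbolic_group :: "('g, 'm) monoid_scheme \<Rightarrow> bool" where
  "hyperbolic_group G \<longleftrightarrow>
     group G \<and>
     (\<exists>S. finite S \<and> S \<subseteq> carrier G \<and> generate G S = carrier G \<and>
          gromov_hyperbolic (carrier G) (word_metric G S))"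

text \<open>Elementary means virtually cyclic; this includes the finite groups.\<close>

definition elementary_group :: "('g, 'm) monoid_scheme \<Rightarrow> bool" where
  "elementary_group G \<longleftrightarrow>
     (\<exists>H. subgroup H G \<and> finite (rcosets\<^bsub>G\<^esub> H) \<and> cyclic_group (G\<lparr>carrier := H\<rparr>))"

definition isometric_action ::
    "('g, 'm) monoid_scheme \<Rightarrow> ('g \<Rightarrow> 'x \<Rightarrow> 'x::metric_space) \<Rightarrow> bool" where
  "isometric_action G act \<longleftrightarrow>
     (\<forall>g\<in>carrier G. \<forall>x y. dist (act g x) (act g y) = dist x y)"

text \<open>The space is not assumed to have compact balls, so properness of the action is
  the metric notion, formulated with bounded rather than compact sets.\<close>

definition proper_action ::
    "('g, 'm) monoid_scheme \<Rightarrow> ('g \<Rightarrow> 'x \<Rightarrow> 'x::metric_space) \<Rightarrow> bool" where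
  "proper_action G act \<longleftrightarrow>
     (\<forall>B. bounded B \<longrightarrow> finite {g \<in> carrier G. act g ` B \<inter> B \<noteq> {}})"

definition cocompact_action ::
    "('g, 'm) monoid_scheme \<Rightarrow> ('g \<Rightarrow> 'x \<Rightarrow> 'x::metric_space) \<Rightarrow> bool" where
  "cocompact_action G act \<longleftrightarrow>
     (\<exists>K. compact K \<and> (\<Union>g\<in>carrier G. act g ` K) = UNIV)"

section \<open>The boundary\<close>

text \<open>Boundary points are equivalence classes of sequences \<open>u\<close> for which the Gromov
  products of \<open>u i\<close> and \<open>u j\<close> tend to infinity as \<open>i\<close> and \<open>j\<close> both do.\<close>

definition converges_at_infinity :: "'x::metric_space \<Rightarrow> (nat \<Rightarrow> 'x) \<Rightarrow> bool" where
  "converges_at_infinity w u \<longleftrightarrow>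
     filterlim (\<lambda>(i, j). gromov_product dist w (u i) (u j)) at_top
       (sequentially \<times>\<^sub>F sequentially)"

definition boundary_rel :: "'x::metric_space \<Rightarrow> ((nat \<Rightarrow> 'x) \<times> (nat \<Rightarrow> 'x)) set" where
  "boundary_rel w =
     {(u, v). converges_at_infinity w u \<and> converges_at_infinity w v \<and>
              filterlim (\<lambda>(i, j). gromov_product dist w (u i) (v j)) at_top
                (sequentially \<times>\<^sub>F sequentially)}"

definition gromov_boundary :: "'x::metric_space \<Rightarrow> (nat \<Rightarrow> 'x) set set" where
  "gromov_boundary w = {u. converges_at_infinity w u} // boundary_rel w"

text \<open>The continuous extension of the Gromov product to pairs of boundary points. The limit
  exists and is independent of the representatives when the space is strongly hyperbolic;
  its value is \<open>\<infinity>\<close> exactly on the diagonal.\<close>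

definition boundary_gromov_product ::
    "'x::metric_space \<Rightarrow> (nat \<Rightarrow> 'x) set \<Rightarrow> (nat \<Rightarrow> 'x) set \<Rightarrow> ereal" where
  "boundary_gromov_product w \<xi> \<eta> =
     (THE L. \<forall>u\<in>\<xi>. \<forall>v\<in>\<eta>.
        ((\<lambda>(i, j). ereal (gromov_product dist w (u i) (v j))) \<longlongrightarrow> L)
          (sequentially \<times>\<^sub>F sequentially))"

definition boundary_dist ::
    "real \<Rightarrow> 'x::metric_space \<Rightarrow> (nat \<Rightarrow> 'x) set \<Rightarrow> (nat \<Rightarrow> 'x) set \<Rightarrow> real" where
  "boundary_dist \<epsilon> w \<xi> \<eta> =
     (if boundary_gromov_product w \<xi> \<eta> = \<infinity> then 0
      else exp (- \<epsilon> * real_of_ereal (boundary_gromov_product w \<xi> \<eta>)))"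

section \<open>Hausdorff measure and dimension\<close>

definition set_diam :: "('a \<Rightarrow> 'a \<Rightarrow> real) \<Rightarrow> 'a set \<Rightarrow> real" where
  "set_diam d U = (SUP (x, y)\<in>U \<times> U. d x y)"

text \<open>The \<open>s\<close>-th power of the diameter, where \<open>0\<^sup>0 = 1\<close> for nonempty sets (in contrast
  to \<open>powr\<close>) and the empty set has gauge 0.\<close>

definition hausdorff_gauge :: "('a \<Rightarrow> 'a \<Rightarrow> real) \<Rightarrow> real \<Rightarrow> 'a set \<Rightarrow> ennreal" where
  "hausdorff_gauge d s U =
     (if U = {} then 0 else if s = 0 then 1 else ennreal (set_diam d U powr s))"

definition hausdorff_premeasure ::
    "'a set \<Rightarrow> ('a \<Rightarrow> 'a \<Rightarrow> real) \<Rightarrow> real \<Rightarrow> real \<Rightarrow> 'a set \<Rightarrow> ennreal" where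
  "hausdorff_premeasure Z d s \<delta> A =
     (INF U \<in> {U :: nat \<Rightarrow> 'a set. A \<subseteq> (\<Union>i. U i) \<and>
                 (\<forall>i. U i \<subseteq> Z \<and> (\<forall>x\<in>U i. \<forall>y\<in>U i. d x y \<le> \<delta>))}.
        \<Sum>i. hausdorff_gauge d s (U i))"

definition hausdorff_outer_measure ::
    "'a set \<Rightarrow> ('a \<Rightarrow> 'a \<Rightarrow> real) \<Rightarrow> real \<Rightarrow> 'a set \<Rightarrow> ennreal" where
  "hausdorff_outer_measure Z d s A = (SUP \<delta>\<in>{0<..}. hausdorff_premeasure Z d s \<delta> A)"

definition hausdorff_measure ::
    "'a set \<Rightarrow> ('a \<Rightarrow> 'a \<Rightarrow> real) \<Rightarrow> real \<Rightarrow> 'a measure" where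
  "hausdorff_measure Z d s =
     measure_of Z {U. openin (Metric_space.mtopology Z d) U} (hausdorff_outer_measure Z d s)"

definition hausdorff_dimension :: "'a set \<Rightarrow> ('a \<Rightarrow> 'a \<Rightarrow> real) \<Rightarrow> ereal" where
  "hausdorff_dimension Z d = Inf {ereal s | s. 0 \<le> s \<and> hausdorff_outer_measure Z d s Z = 0}"

definition ahlfors_regular ::
    "'a set \<Rightarrow> ('a \<Rightarrow> 'a \<Rightarrow> real) \<Rightarrow> 'a measure \<Rightarrow> real \<Rightarrow> bool" where
  "ahlfors_regular Z d \<nu> D \<longleftrightarrow>
     (\<exists>C\<ge>1. \<forall>\<xi>\<in>Z. \<forall>r. 0 \<le> r \<and> r \<le> set_diam d Z \<longrightarrow>
        ennreal (r powr D / C) \<le> emeasure \<nu> {\<eta> \<in> Z. d \<xi> \<eta> \<le> r} \<and>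
        emeasure \<nu> {\<eta> \<in> Z. d \<xi> \<eta> \<le> r} \<le> ennreal (C * r powr D))"

section \<open>Function spaces\<close>

text \<open>Elements of the spaces below are represented by functions, so the norms are
  seminorms that vanish exactly on the functions that are zero almost everywhere. The scalar
  type \<open>'k\<close> of class \<open>{real_normed_field, euclidean_space}\<close> stands for the field of
  real or complex numbers.\<close>

definition Lp_space ::
    "'a measure \<Rightarrow> real \<Rightarrow> ('a \<Rightarrow> 'k::{real_normed_field, euclidean_space}) set" where
  "Lp_space M p = {f \<in> borel_measurable M. integrable M (\<lambda>x. norm (f x) powr p)}"

definition Lp_norm ::
    "'a measure \<Rightarrow> real \<Rightarrow> ('a \<Rightarrow> 'k::{real_normed_field, euclidean_space}) \<Rightarrow> real" where
  "Lp_norm M p f = (\<integral>x. norm (f x) powr p \<partial>M) powr (1 / p)"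

text \<open>On the diagonal the integrand is \<open>0 / 0 = 0\<close>.\<close>

definition log_energy ::
    "('a \<Rightarrow> 'a \<Rightarrow> real) \<Rightarrow> 'a measure \<Rightarrow> real \<Rightarrow> real \<Rightarrow>
     ('a \<Rightarrow> 'k::{real_normed_field, euclidean_space}) \<Rightarrow> ennreal" where
  "log_energy d \<nu> D p f =
     (\<integral>\<^sup>+ \<xi>. (\<integral>\<^sup>+ \<eta>. ennreal (norm (f \<xi> - f \<eta>) powr p / d \<xi> \<eta> powr D) \<partial>\<nu>) \<partial>\<nu>)"

definition Wlog_space ::
    "('a \<Rightarrow> 'a \<Rightarrow> real) \<Rightarrow> 'a measure \<Rightarrow> real \<Rightarrow> real \<Rightarrow>
     ('a \<Rightarrow> 'k::{real_normed_field, euclidean_space}) set" where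
  "Wlog_space d \<nu> D p = {f \<in> Lp_space \<nu> p. log_energy d \<nu> D p f < \<infinity>}"

definition Wlog_norm ::
    "('a \<Rightarrow> 'a \<Rightarrow> real) \<Rightarrow> 'a measure \<Rightarrow> real \<Rightarrow> real \<Rightarrow>
     ('a \<Rightarrow> 'k::{real_normed_field, euclidean_space}) \<Rightarrow> real" where
  "Wlog_norm d \<nu> D p f =
     (Lp_norm \<nu> p f powr p + enn2real (log_energy d \<nu> D p f)) powr (1 / p)"

text \<open>A compact operator between spaces of functions, with carriers \<open>E\<close>, \<open>F\<close> and seminorms
  \<open>NE\<close>, \<open>NF\<close>: a linear map (up to elements of seminorm 0) under which the image of every
  bounded sequence has a convergent subsequence.\<close>

definition compact_operator ::
    "('a \<Rightarrow> 'k::real_normed_field) set \<Rightarrow> (('a \<Rightarrow> 'k) \<Rightarrow> real) \<Rightarrow>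
     ('b \<Rightarrow> 'k) set \<Rightarrow> (('b \<Rightarrow> 'k) \<Rightarrow> real) \<Rightarrow>
     (('a \<Rightarrow> 'k) \<Rightarrow> ('b \<Rightarrow> 'k)) \<Rightarrow> bool" where
  "compact_operator E NE F NF T \<longleftrightarrow>
     T \<in> E \<rightarrow> F \<and>
     (\<forall>f\<in>E. \<forall>g\<in>E. \<forall>a b.
        (\<lambda>x. a * f x + b * g x) \<in> E \<and>
        NF (\<lambda>y. T (\<lambda>x. a * f x + b * g x) y - (a * T f y + b * T g y)) = 0) \<and>
     (\<forall>u :: nat \<Rightarrow> 'a \<Rightarrow> 'k.
        (\<forall>n. u n \<in> E) \<and> (\<exists>C. \<forall>n. NE (u n) \<le> C) \<longrightarrow>
        (\<exists>g\<in>F. \<exists>r. strict_mono r \<and>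
           (\<lambda>n. NF (\<lambda>y. T (u (r n)) y - g y)) \<longlonglongrightarrow> 0))"

end

theory Submission
  imports Defs "HOL-Library.Diagonal_Subsequence"
begin

text \<open>Strong hyperbolicity makes \<open>exp (- \<epsilon> \<langle>x,y\<rangle>)\<close> satisfy the triangle inequality on the space, and
  hence \<open>d\<close> is a metric on the boundary; from then on only the Ahlfors regularity of \<open>(Z, d, \<nu>)\<close> is
  relevant. The kernel \<open>1 / d(x,y)\<^sup>D\<close> just fails to be integrable: its integral over \<open>d(x,y) \<ge> r\<close>
  grows like \<open>log (1/r)\<close>, uniformly in \<open>x\<close>. Averaging \<open>\<phi>\<close> against the kernel truncated at a small
  scale and normalised therefore changes \<open>\<phi>\<close> in \<open>L\<^sup>p\<close> by a small multiple of its energy. Made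
  piecewise constant on a finite partition, the kernel defines an operator of finite rank, so that
  \<open>\<parallel>\<phi>\<parallel>\<^sup>p \<le> e E(\<phi>) + C (\<Sum>\<^sub>j |\<integral> \<phi> over A\<^sub>j|)\<^sup>p\<close> for every \<open>e > 0\<close>, with finitely many sets \<open>A\<^sub>j\<close>
  depending on \<open>e\<close>. A diagonal subsequence along which all these integrals converge is then Cauchy
  in \<open>L\<^sup>p\<close>.\<close>

section \<open>The visual metric on the boundary\<close>

text \<open>The inequality in strong hyperbolicity is the triangle inequality for this quantity. It
  is not a metric on the space itself, being positive also on the diagonal; its limits at the
  boundary form one.\<close>

definition visual :: "real \<Rightarrow> 'x::metric_space \<Rightarrow> 'x \<Rightarrow> 'x \<Rightarrow> real" where
  "visual \<epsilon> w x y = exp (- \<epsilon> * gromov_product dist w x y)"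

lemma visual_pos: "0 < visual \<epsilon> w x y"
  by (simp add: visual_def)

lemma visual_commute: "visual \<epsilon> w x y = visual \<epsilon> w y x"
  by (simp add: visual_def gromov_product_def dist_commute add.commute)

lemma visual_triangle:
  assumes "strongly_hyperbolic (UNIV :: 'x::metric_space set) dist \<epsilon>"
  shows "visual \<epsilon> w x z \<le> visual \<epsilon> w x y + visual \<epsilon> w y (z::'x)"
  using assms unfolding strongly_hyperbolic_def visual_def by blast

lemma gromov_product_eq_visual:
  assumes "\<epsilon> > 0"
  shows "gromov_product dist w x y = - ln (visual \<epsilon> w x y) / \<epsilon>"
  using assms by (simp add: visual_def)

lemma visual_le_1:
  assumes "\<epsilon> > 0"
  shows "visual \<epsilon> w x y \<le> 1"
proof -
  have "gromov_product dist w x y \<ge> 0"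
    using dist_triangle2[of x y w] by (simp add: gromov_product_def dist_commute)
  then show ?thesis using assms by (simp add: visual_def)
qed

text \<open>\<open>exp\<close> and \<open>ln\<close> exchange the two limits since \<epsilon> > 0.
  Conditions on boundary sequences thereby become smallness of a quantity that, under strong
  hyperbolicity, obeys the triangle inequality.\<close>

lemma filterlim_gromov_product_iff:
  assumes "\<epsilon> > 0"
  shows "filterlim (\<lambda>(i, j). gromov_product dist w (u i) (v j)) at_top F \<longleftrightarrow>
         ((\<lambda>(i, j). visual \<epsilon> w (u i) (v j)) \<longlongrightarrow> 0) F"
proof
  assume L: "filterlim (\<lambda>(i, j). gromov_product dist w (u i) (v j)) at_top F"
  have "filterlim (\<lambda>z. \<epsilon> * (case z of (i, j) \<Rightarrow> gromov_product dist w (u i) (v j))) at_top F"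
    by (rule filterlim_tendsto_pos_mult_at_top[OF tendsto_const assms L])
  then have "((\<lambda>z. exp (- (\<epsilon> * (case z of (i, j) \<Rightarrow> gromov_product dist w (u i) (v j))))) \<longlongrightarrow> 0) F"
    by (intro filterlim_compose[OF exp_at_bot]) (simp add: filterlim_uminus_at_bot)
  then show "((\<lambda>(i, j). visual \<epsilon> w (u i) (v j)) \<longlongrightarrow> 0) F"
    by (simp add: visual_def case_prod_unfold)
next
  assume L: "((\<lambda>(i, j). visual \<epsilon> w (u i) (v j)) \<longlongrightarrow> 0) F"
  then have "filterlim (\<lambda>z. ln (case z of (i, j) \<Rightarrow> visual \<epsilon> w (u i) (v j))) at_bot F"
    by (intro filterlim_compose[OF ln_at_0])
       (auto simp: filterlim_at case_prod_unfold visual_pos less_imp_neq[OF visual_pos, symmetric])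
  then have "filterlim (\<lambda>z. - ln (case z of (i, j) \<Rightarrow> visual \<epsilon> w (u i) (v j))) at_top F"
    by (simp add: filterlim_uminus_at_top)
  then have "filterlim (\<lambda>z. (1/\<epsilon>) * - ln (case z of (i, j) \<Rightarrow> visual \<epsilon> w (u i) (v j))) at_top F"
    using assms by (intro filterlim_tendsto_pos_mult_at_top[OF tendsto_const]) auto
  then show "filterlim (\<lambda>(i, j). gromov_product dist w (u i) (v j)) at_top F"
    using assms by (simp add: gromov_product_eq_visual case_prod_unfold)
qed

lemma tendsto_prod_sequentially_iff:
  fixes f :: "nat \<Rightarrow> nat \<Rightarrow> real"
  shows "((\<lambda>(i, j). f i j) \<longlongrightarrow> l) (sequentially \<times>\<^sub>F sequentially) \<longleftrightarrow>
         (\<forall>e>0. \<exists>N. \<forall>i\<ge>N. \<forall>j\<ge>N. \<bar>f i j - l\<bar> < e)"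
  unfolding tendsto_iff eventually_prod_sequentially dist_real_def case_prod_conv
proof -
  \<comment> \<open>\<open>eventually_prod_sequentially\<close> binds the two indices in the
    opposite order.\<close>
  have "(\<exists>N. \<forall>m\<ge>N. \<forall>n\<ge>N. \<bar>f n m - l\<bar> < e) \<longleftrightarrow> (\<exists>N. \<forall>i\<ge>N. \<forall>j\<ge>N. \<bar>f i j - l\<bar> < e)" for e
    by blast
  then show "(\<forall>e>0. \<exists>N. \<forall>m\<ge>N. \<forall>n\<ge>N. \<bar>f n m - l\<bar> < e) \<longleftrightarrow>
      (\<forall>e>0. \<exists>N. \<forall>i\<ge>N. \<forall>j\<ge>N. \<bar>f i j - l\<bar> < e)"
    by simp
qed

lemma converges_at_infinity_iff:
  assumes "\<epsilon> > 0"
  shows "converges_at_infinity w u \<longleftrightarrow> (\<forall>e>0. \<exists>N. \<forall>i\<ge>N. \<forall>j\<ge>N. visual \<epsilon> w (u i) (u j) < e)"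
  unfolding converges_at_infinity_def filterlim_gromov_product_iff[OF assms]
    tendsto_prod_sequentially_iff using visual_pos[of \<epsilon> w] by (simp add: abs_of_pos)

lemma boundary_rel_iff:
  assumes "\<epsilon> > 0"
  shows "(u, v) \<in> boundary_rel w \<longleftrightarrow> converges_at_infinity w u \<and> converges_at_infinity w v \<and>
    (\<forall>e>0. \<exists>N. \<forall>i\<ge>N. \<forall>j\<ge>N. visual \<epsilon> w (u i) (v j) < e)"
  unfolding boundary_rel_def mem_Collect_eq case_prod_conv filterlim_gromov_product_iff[OF assms]
    tendsto_prod_sequentially_iff using visual_pos[of \<epsilon> w] by (simp add: abs_of_pos)

section \<open>Limits of the Gromov product and the metric axioms\<close>

context
  fixes \<epsilon> :: real and w :: "'x::metric_space"
  assumes hyp: "strongly_hyperbolic (UNIV :: 'x set) dist \<epsilon>"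
begin

lemma strongly_hyperbolic_pos: "\<epsilon> > 0"
  using hyp by (simp add: strongly_hyperbolic_def)

lemmas visual_tri = visual_triangle[OF hyp, of w]
lemmas conv_at_infinity_iff = converges_at_infinity_iff[OF strongly_hyperbolic_pos, of w]
lemmas equivalent_sequences_iff = boundary_rel_iff[OF strongly_hyperbolic_pos, of _ _ w]

lemma equiv_boundary_rel: "equiv {u. converges_at_infinity w u} (boundary_rel w)"
proof (rule equivI)
  show "boundary_rel w \<subseteq> {u. converges_at_infinity w u} \<times> {u. converges_at_infinity w u}"
    by (auto simp: boundary_rel_def)
  \<comment> \<open>A sequence converges at infinity exactly when it is related to itself: both
    conditions let the two indices run independently.\<close>
  show "refl_on {u. converges_at_infinity w u} (boundary_rel w)"
    by (auto simp: refl_on_def equivalent_sequences_iff conv_at_infinity_iff)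
  show "sym (boundary_rel w)"
    by (rule symI) (metis equivalent_sequences_iff visual_commute)
  show "trans (boundary_rel w)"
  proof (rule transI)
    fix u v x assume uv: "(u, v) \<in> boundary_rel w" and vx: "(v, x) \<in> boundary_rel w"
    have "\<exists>N. \<forall>i\<ge>N. \<forall>j\<ge>N. visual \<epsilon> w (u i) (x j) < e" if "e > 0" for e
    proof -
      have e: "e/2 > 0" using that by simp
      obtain N where N: "\<And>i j. i \<ge> N \<Longrightarrow> j \<ge> N \<Longrightarrow> visual \<epsilon> w (u i) (v j) < e/2"
        using uv e unfolding equivalent_sequences_iff by meson
      obtain M where M: "\<And>i j. i \<ge> M \<Longrightarrow> j \<ge> M \<Longrightarrow> visual \<epsilon> w (v i) (x j) < e/2"
        using vx e unfolding equivalent_sequences_iff by meson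
      have "visual \<epsilon> w (u i) (x j) < e" if "i \<ge> max N M" "j \<ge> max N M" for i j
        using N[of i "max N M"] M[of "max N M" j] visual_tri[of "u i" "x j" "v (max N M)"] that by simp
      then show ?thesis by blast
    qed
    then show "(u, x) \<in> boundary_rel w" using uv vx unfolding equivalent_sequences_iff by blast
  qed
qed

text \<open>Two applications of the triangle inequality in each direction, moving one argument at a
  time. Replacing sequences by equivalent ones therefore hardly changes \<open>visual\<close> far
  out.\<close>

lemma visual_cross_le:
  "\<bar>visual \<epsilon> w a b - visual \<epsilon> w a' b'\<bar> \<le> visual \<epsilon> w a a' + visual \<epsilon> w b b'"
  using visual_tri[of a b a'] visual_tri[of a' b b'] visual_tri[of a' b' a] visual_tri[of a b' b]
    visual_commute[of \<epsilon> w a' a] visual_commute[of \<epsilon> w b' b] by linarith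

text \<open>By \<open>visual_cross_le\<close> the values at all late indices are uniformly close,
  even across equivalent sequences. Applied to the given pair itself this is the Cauchy property; in
  general it carries the limit over to all representatives.\<close>

lemma visual_limit_exists:
  assumes u: "converges_at_infinity w u" and v: "converges_at_infinity w v"
  obtains l where "\<And>u' v'. (u, u') \<in> boundary_rel w \<Longrightarrow> (v, v') \<in> boundary_rel w \<Longrightarrow>
    ((\<lambda>(i, j). visual \<epsilon> w (u' i) (v' j)) \<longlongrightarrow> l) (sequentially \<times>\<^sub>F sequentially)"
proof -
  let ?E = "visual \<epsilon> w"
  have cross: "\<exists>N. \<forall>i\<ge>N. \<forall>j\<ge>N. \<forall>i'\<ge>N. \<forall>j'\<ge>N. \<bar>?E (u i) (v j) - ?E (u' i') (v' j')\<bar> < e"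
    if uv': "(u, u') \<in> boundary_rel w" "(v, v') \<in> boundary_rel w" and "e > 0" for u' v' e
  proof -
    have e: "e/2 > 0" using \<open>e > 0\<close> by simp
    obtain N where N: "\<And>i j. i \<ge> N \<Longrightarrow> j \<ge> N \<Longrightarrow> ?E (u i) (u' j) < e/2"
      using uv'(1) e unfolding equivalent_sequences_iff by meson
    obtain M where M: "\<And>i j. i \<ge> M \<Longrightarrow> j \<ge> M \<Longrightarrow> ?E (v i) (v' j) < e/2"
      using uv'(2) e unfolding equivalent_sequences_iff by meson
    have "\<bar>?E (u i) (v j) - ?E (u' i') (v' j')\<bar> < e"
      if "i \<ge> max N M" "j \<ge> max N M" "i' \<ge> max N M" "j' \<ge> max N M" for i j i' j'
      using visual_cross_le[of "u i" "v j" "u' i'" "v' j'"] N[of i i'] M[of j j'] that by simp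
    then show ?thesis by blast
  qed
  have uu: "(u, u) \<in> boundary_rel w" "(v, v) \<in> boundary_rel w"
    using u v by (simp_all add: equivalent_sequences_iff conv_at_infinity_iff)
  have "Cauchy (\<lambda>n. ?E (u n) (v n))"
  proof (rule CauchyI)
    fix e :: real assume "e > 0"
    from cross[OF uu this] show "\<exists>M. \<forall>m\<ge>M. \<forall>n\<ge>M. norm (?E (u m) (v m) - ?E (u n) (v n)) < e"
      unfolding real_norm_def by blast
  qed
  then obtain l where l: "(\<lambda>n. ?E (u n) (v n)) \<longlonglongrightarrow> l"
    using Cauchy_convergent convergent_def by blast
  have "((\<lambda>(i, j). ?E (u' i) (v' j)) \<longlongrightarrow> l) (sequentially \<times>\<^sub>F sequentially)"
    if uv': "(u, u') \<in> boundary_rel w" "(v, v') \<in> boundary_rel w" for u' v'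
    unfolding tendsto_prod_sequentially_iff
  proof (intro allI impI)
    fix e :: real assume "e > 0"
    then have e: "e/2 > 0" by simp
    obtain N where N: "\<And>i j i' j'. i \<ge> N \<Longrightarrow> j \<ge> N \<Longrightarrow> i' \<ge> N \<Longrightarrow> j' \<ge> N \<Longrightarrow>
        \<bar>?E (u i) (v j) - ?E (u' i') (v' j')\<bar> < e/2"
      using cross[OF uv' e] by blast
    obtain M where M: "\<And>n. n \<ge> M \<Longrightarrow> \<bar>?E (u n) (v n) - l\<bar> < e/2"
      using LIMSEQ_D[OF l e] by (auto simp: real_norm_def)
    \<comment> \<open>The comparison goes through the diagonal term at \<open>max N M\<close>, which
      lies beyond both thresholds.\<close>
    have "\<bar>?E (u' i) (v' j) - l\<bar> < e" if "i \<ge> N" "j \<ge> N" for i j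
      using N[OF max.cobounded1 max.cobounded1 that, of M M] M[OF max.cobounded2, of N]
      by linarith
    then show "\<exists>N. \<forall>i\<ge>N. \<forall>j\<ge>N. \<bar>?E (u' i) (v' j) - l\<bar> < e" by blast
  qed
  then show ?thesis by (rule that)
qed

lemma gromov_boundary_cases:
  assumes "\<xi> \<in> gromov_boundary w"
  obtains u where "converges_at_infinity w u" "\<xi> = boundary_rel w `` {u}" "u \<in> \<xi>"
  using assms unfolding gromov_boundary_def
  by (auto elim!: quotientE simp: equivalent_sequences_iff conv_at_infinity_iff)

text \<open>Replaces the definite description behind the metric by a plain limit along arbitrary
  representatives, from which separation of points and the triangle inequality are read off.\<close>

lemma visual_tendsto_boundary_dist:
  assumes \<xi>: "\<xi> \<in> gromov_boundary w" and \<eta>: "\<eta> \<in> gromov_boundary w"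
    and u': "u' \<in> \<xi>" and v': "v' \<in> \<eta>"
  shows "((\<lambda>(i, j). visual \<epsilon> w (u' i) (v' j)) \<longlongrightarrow> boundary_dist \<epsilon> w \<xi> \<eta>)
    (sequentially \<times>\<^sub>F sequentially)"
proof -
  let ?F = "sequentially \<times>\<^sub>F sequentially :: (nat \<times> nat) filter"
  have F: "?F \<noteq> bot" by (simp add: prod_filter_eq_bot)
  obtain u where u: "converges_at_infinity w u" "\<xi> = boundary_rel w `` {u}" "u \<in> \<xi>"
    using gromov_boundary_cases[OF \<xi>] .
  obtain v where v: "converges_at_infinity w v" "\<eta> = boundary_rel w `` {v}" "v \<in> \<eta>"
    using gromov_boundary_cases[OF \<eta>] .
  obtain l where l: "\<And>u' v'. (u, u') \<in> boundary_rel w \<Longrightarrow> (v, v') \<in> boundary_rel w \<Longrightarrow>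
      ((\<lambda>(i, j). visual \<epsilon> w (u' i) (v' j)) \<longlongrightarrow> l) ?F"
    using visual_limit_exists[OF u(1) v(1)] by blast
  have l': "((\<lambda>(i, j). visual \<epsilon> w (u' i) (v' j)) \<longlongrightarrow> l) ?F" if "u' \<in> \<xi>" "v' \<in> \<eta>" for u' v'
    using that l u(2) v(2) by blast
  have "l \<ge> 0"
    by (rule tendsto_lowerbound[OF l'[OF u(3) v(3)] _ F])
       (auto intro!: always_eventually simp: visual_pos less_imp_le)
  \<comment> \<open>The candidate for the extended Gromov product; \<open>boundary_dist\<close>
    turns it back into \<open>l\<close>, infinity standing for \<open>l = 0\<close>.\<close>
  define L where "L = (if l = 0 then \<infinity> else ereal (- ln l / \<epsilon>))"
  have lim: "((\<lambda>(i, j). ereal (gromov_product dist w (u' i) (v' j))) \<longlongrightarrow> L) ?F"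
    if uv: "u' \<in> \<xi>" "v' \<in> \<eta>" for u' v'
  proof (cases "l = 0")
    case True
    then have "filterlim (\<lambda>(i, j). gromov_product dist w (u' i) (v' j)) at_top ?F"
      using l'[OF uv] filterlim_gromov_product_iff[OF strongly_hyperbolic_pos] by blast
    then show ?thesis
      using True by (simp add: L_def tendsto_PInfty_eq_at_top case_prod_unfold)
  next
    case False
    have "((\<lambda>z. ereal (- ln (case z of (i, j) \<Rightarrow> visual \<epsilon> w (u' i) (v' j)) / \<epsilon>)) \<longlongrightarrow> L) ?F"
      using l'[OF uv] False strongly_hyperbolic_pos unfolding L_def by (auto intro!: tendsto_intros)
    then show ?thesis
      by (simp add: gromov_product_eq_visual[OF strongly_hyperbolic_pos] case_prod_unfold)
  qed
  have "boundary_gromov_product w \<xi> \<eta> = L"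
    unfolding boundary_gromov_product_def
  proof (rule the_equality)
    fix L' assume "\<forall>u\<in>\<xi>. \<forall>v\<in>\<eta>. ((\<lambda>(i, j). ereal (gromov_product dist w (u i) (v j))) \<longlongrightarrow> L') ?F"
    then show "L' = L" using tendsto_unique[OF F _ lim[OF u(3) v(3)]] u(3) v(3) by blast
  qed (use lim in blast)
  then have "boundary_dist \<epsilon> w \<xi> \<eta> = l"
    using \<open>l \<ge> 0\<close> strongly_hyperbolic_pos by (auto simp: boundary_dist_def L_def)
  then show ?thesis using l'[OF u' v'] by simp
qed

lemma visual_diagonal_tendsto_boundary_dist:
  assumes "\<xi> \<in> gromov_boundary w" "\<eta> \<in> gromov_boundary w" "u \<in> \<xi>" "v \<in> \<eta>"
  shows "(\<lambda>n. visual \<epsilon> w (u n) (v n)) \<longlonglongrightarrow> boundary_dist \<epsilon> w \<xi> \<eta>"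
proof (rule LIMSEQ_I)
  fix e :: real assume "e > 0"
  then show "\<exists>N. \<forall>n\<ge>N. norm (visual \<epsilon> w (u n) (v n) - boundary_dist \<epsilon> w \<xi> \<eta>) < e"
    using visual_tendsto_boundary_dist[OF assms] unfolding tendsto_prod_sequentially_iff
    by (metis real_norm_def)
qed

text \<open>\<open>Metric_space\<close> asks for symmetry at all arguments, also off the boundary,
  where no limit is known. Swapping the indices shows that both definite descriptions have the same
  defining condition.\<close>

lemma boundary_dist_commute: "boundary_dist \<epsilon> w \<xi> \<eta> = boundary_dist \<epsilon> w \<eta> \<xi>"
proof -
  have "((\<lambda>(i, j). ereal (gromov_product dist w (u i) (v j))) \<longlongrightarrow> L) (sequentially \<times>\<^sub>F sequentially)"
    if "((\<lambda>(i, j). ereal (gromov_product dist w (v i) (u j))) \<longlongrightarrow> L) (sequentially \<times>\<^sub>F sequentially)"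
    for u v L
  proof -
    have "filterlim prod.swap (sequentially \<times>\<^sub>F sequentially) (sequentially \<times>\<^sub>F sequentially :: (nat \<times> nat) filter)"
      unfolding filterlim_iff eventually_prod_sequentially by (auto simp: prod.swap_def)
    from filterlim_compose[OF that this] show ?thesis
      by (simp add: case_prod_unfold gromov_product_def dist_commute add.commute)
  qed
  then have "boundary_gromov_product w \<xi> \<eta> = boundary_gromov_product w \<eta> \<xi>"
    unfolding boundary_gromov_product_def by (intro arg_cong[where f = The] ext) blast
  then show ?thesis by (simp add: boundary_dist_def)
qed

text \<open>Ensures that the supremum in \<open>set_diam\<close> is taken over a bounded
  set.\<close>

lemma boundary_dist_le_1:
  assumes "\<xi> \<in> gromov_boundary w" "\<eta> \<in> gromov_boundary w"
  shows "boundary_dist \<epsilon> w \<xi> \<eta> \<le> 1"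
proof -
  obtain u v where "u \<in> \<xi>" "v \<in> \<eta>"
    using assms by (meson gromov_boundary_cases)
  from visual_diagonal_tendsto_boundary_dist[OF assms this] show ?thesis
    by (rule LIMSEQ_le_const2) (auto intro: visual_le_1[OF strongly_hyperbolic_pos])
qed

lemma Metric_space_boundary: "Metric_space (gromov_boundary w) (boundary_dist \<epsilon> w)"
proof
  show "0 \<le> boundary_dist \<epsilon> w \<xi> \<eta>" for \<xi> \<eta>
    by (simp add: boundary_dist_def)
  show "boundary_dist \<epsilon> w \<xi> \<eta> = boundary_dist \<epsilon> w \<eta> \<xi>" for \<xi> \<eta>
    by (rule boundary_dist_commute)
next
  fix \<xi> \<eta> assume *: "\<xi> \<in> gromov_boundary w" "\<eta> \<in> gromov_boundary w"
  obtain u where u: "converges_at_infinity w u" "\<xi> = boundary_rel w `` {u}" "u \<in> \<xi>"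
    using gromov_boundary_cases[OF *(1)] .
  obtain v where v: "converges_at_infinity w v" "\<eta> = boundary_rel w `` {v}" "v \<in> \<eta>"
    using gromov_boundary_cases[OF *(2)] .
  note lim = visual_tendsto_boundary_dist[OF * u(3) v(3)]
  \<comment> \<open>Limits along the product filter are unique, so distance 0 means that
    \<open>visual\<close> tends to 0, which is the condition defining equivalence.\<close>
  have "boundary_dist \<epsilon> w \<xi> \<eta> = 0 \<longleftrightarrow>
      ((\<lambda>(i, j). visual \<epsilon> w (u i) (v j)) \<longlongrightarrow> 0) (sequentially \<times>\<^sub>F sequentially)"
    using lim tendsto_unique[OF _ lim, of 0] by (metis prod_filter_eq_bot sequentially_bot)
  also have "\<dots> \<longleftrightarrow> (u, v) \<in> boundary_rel w"
    using u(1) v(1) filterlim_gromov_product_iff[OF strongly_hyperbolic_pos, of w u v]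
    by (simp add: boundary_rel_def)
  also have "\<dots> \<longleftrightarrow> \<xi> = \<eta>"
    using eq_equiv_class_iff[OF equiv_boundary_rel] u(1,2) v(1,2) by simp
  finally show "boundary_dist \<epsilon> w \<xi> \<eta> = 0 \<longleftrightarrow> \<xi> = \<eta>" .
next
  fix \<xi> \<eta> \<zeta>
  assume *: "\<xi> \<in> gromov_boundary w" "\<eta> \<in> gromov_boundary w" "\<zeta> \<in> gromov_boundary w"
  obtain u v x where m: "u \<in> \<xi>" "v \<in> \<eta>" "x \<in> \<zeta>"
    using * by (meson gromov_boundary_cases)
  show "boundary_dist \<epsilon> w \<xi> \<zeta> \<le> boundary_dist \<epsilon> w \<xi> \<eta> + boundary_dist \<epsilon> w \<eta> \<zeta>"
    using visual_diagonal_tendsto_boundary_dist[OF *(1,3) m(1,3)]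
      tendsto_add[OF visual_diagonal_tendsto_boundary_dist[OF *(1,2) m(1,2)]
        visual_diagonal_tendsto_boundary_dist[OF *(2,3) m(2,3)]]
    by (rule LIMSEQ_le) (blast intro: visual_tri)
qed

end

section \<open>Spaces of p-integrable functions\<close>

lemma add_powr_le:
  fixes s t p :: real
  assumes "0 \<le> s" "0 \<le> t" "0 \<le> p"
  shows "(s + t) powr p \<le> 2 powr p * (s powr p + t powr p)"
proof -
  have "(s + t) powr p \<le> (2 * max s t) powr p"
    using assms by (intro powr_mono2) auto
  also have "\<dots> = 2 powr p * max s t powr p"
    using assms by (simp add: powr_mult)
  also have "\<dots> \<le> 2 powr p * (s powr p + t powr p)"
    by (intro mult_left_mono) (auto simp: max_def)
  finally show ?thesis .
qed

lemma norm_lincomb_powr_le: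
  fixes a b x y :: "'k::real_normed_field"
  assumes "0 \<le> p"
  shows "norm (a * x + b * y) powr p \<le>
    2 powr p * norm a powr p * norm x powr p + 2 powr p * norm b powr p * norm y powr p"
proof -
  have "norm (a * x + b * y) powr p \<le> (norm (a * x) + norm (b * y)) powr p"
    using assms by (intro powr_mono2 norm_triangle_ineq) auto
  also have "\<dots> \<le> 2 powr p * (norm (a * x) powr p + norm (b * y) powr p)"
    using assms by (intro add_powr_le) auto
  finally show ?thesis by (simp add: norm_mult powr_mult algebra_simps)
qed

text \<open>For \<open>t > c\<close> write \<open>t = t powr (1 - p) * t powr p\<close>, where the
  first factor does not increase with \<open>t\<close>. With \<open>c\<close> left free, this stands
  in for the Young and Hoelder inequalities.\<close>

lemma le_add_powr:
  fixes t c p :: real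
  assumes "0 \<le> t" "0 < c" "1 \<le> p"
  shows "t \<le> c + c powr (1 - p) * t powr p"
proof (cases "t \<le> c")
  case False
  then have "c powr (p - 1) \<le> t powr (p - 1)" using assms by (intro powr_mono2) auto
  then have "t * c powr (p - 1) \<le> t powr p"
    using assms False by (simp add: powr_diff field_simps)
  then have "t \<le> c powr (1 - p) * t powr p"
    using assms by (simp add: powr_diff field_simps)
  then show ?thesis using assms by simp
qed (use assms in \<open>simp add: add_increasing2\<close>)

text \<open>Jensen's inequality for the normalised density \<open>k\<close>, weakened by the factor
  \<open>2 powr p\<close>: \<open>le_add_powr\<close> is integrated against \<open>k\<close> and
  \<open>c\<close> is then optimised.\<close>

lemma weighted_mean_powr_le:
  fixes k t :: "'a \<Rightarrow> real"
  assumes k: "integrable M k" and kt: "integrable M (\<lambda>x. k x * t x)"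
    and ktp: "integrable M (\<lambda>x. k x * t x powr p)"
    and pos: "\<And>x. x \<in> space M \<Longrightarrow> 0 \<le> k x" "\<And>x. x \<in> space M \<Longrightarrow> 0 \<le> t x"
    and p: "1 \<le> p" and K: "0 < (\<integral>x. k x \<partial>M)"
  shows "((\<integral>x. k x * t x \<partial>M) / (\<integral>x. k x \<partial>M)) powr p \<le>
    2 powr p * (\<integral>x. k x * t x powr p \<partial>M) / (\<integral>x. k x \<partial>M)"
proof -
  define K where "K = (\<integral>x. k x \<partial>M)"
  define Q where "Q = (\<integral>x. k x * t x powr p \<partial>M)"
  define T where "T = (\<integral>x. k x * t x \<partial>M)"
  have "0 \<le> Q" unfolding Q_def by (intro integral_nonneg_AE AE_I2) (simp add: pos)
  have "0 \<le> T" unfolding T_def by (intro integral_nonneg_AE AE_I2) (simp add: pos)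
  have "0 < K" using K by (simp add: K_def)
  have young: "T \<le> c * K + c powr (1 - p) * Q" if "0 < c" for c
  proof -
    have "T \<le> (\<integral>x. c * k x + c powr (1 - p) * (k x * t x powr p) \<partial>M)"
      unfolding T_def
    proof (rule integral_mono)
      fix x assume x: "x \<in> space M"
      have "k x * t x \<le> k x * (c + c powr (1 - p) * t x powr p)"
        using le_add_powr[OF pos(2)[OF x] that p] pos(1)[OF x] by (intro mult_left_mono)
      then show "k x * t x \<le> c * k x + c powr (1 - p) * (k x * t x powr p)"
        by (simp add: algebra_simps)
    qed (use k kt ktp in auto)
    then show ?thesis using k ktp by (simp add: K_def Q_def)
  qed
  have "(T / K) powr p \<le> 2 powr p * Q / K"
  proof (cases "Q = 0")
    \<comment> \<open>Now \<open>c\<close> can be taken arbitrarily small, which leaves no room for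
      a positive \<open>T\<close>.\<close>
    case True
    have "T \<le> 0"
    proof (rule field_le_epsilon)
      fix e :: real assume "0 < e"
      then show "T \<le> 0 + e" using young[of "e / K"] \<open>0 < K\<close> True by simp
    qed
    then show ?thesis using \<open>0 \<le> T\<close> True by simp
  next
    case False
    \<comment> \<open>This value makes the two terms of \<open>young\<close> equal.\<close>
    define c where "c = (Q / K) powr (1 / p)"
    have QK: "0 < Q / K" using False \<open>0 \<le> Q\<close> \<open>0 < K\<close> by simp
    have c: "0 < c" using False \<open>0 < K\<close> by (simp add: c_def)
    have cp: "c powr p = Q / K" using p \<open>0 < K\<close> \<open>0 \<le> Q\<close> by (simp add: c_def powr_powr)
    have "c powr (1 - p) * Q = c powr (1 - p) * c powr p * K"
      using \<open>0 < K\<close> by (simp add: cp)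
    also have "\<dots> = c * K" using c by (simp flip: powr_add)
    finally have "T \<le> 2 * c * K" using young[OF c] by (simp add: ac_simps)
    then have "T / K \<le> 2 * c" using \<open>0 < K\<close> by (simp add: field_simps)
    then have "(T / K) powr p \<le> (2 * c) powr p"
      using \<open>0 \<le> T\<close> \<open>0 < K\<close> p by (intro powr_mono2) auto
    then show ?thesis using c by (simp add: powr_mult cp)
  qed
  then show ?thesis by (simp add: K_def Q_def T_def)
qed

lemma Lp_space_lincomb:
  fixes f g :: "'a \<Rightarrow> 'k::{real_normed_field, euclidean_space}"
  assumes "f \<in> Lp_space M p" "g \<in> Lp_space M p" "0 \<le> p"
  shows "(\<lambda>x. a * f x + b * g x) \<in> Lp_space M p"
proof -
  have [measurable]: "f \<in> borel_measurable M" "g \<in> borel_measurable M"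
    and int: "integrable M (\<lambda>x. norm (f x) powr p)" "integrable M (\<lambda>x. norm (g x) powr p)"
    using assms by (auto simp: Lp_space_def)
  have "integrable M (\<lambda>x. 2 powr p * norm a powr p * norm (f x) powr p +
      2 powr p * norm b powr p * norm (g x) powr p)"
    using int by simp
  then have "integrable M (\<lambda>x. norm (a * f x + b * g x) powr p)"
    by (rule Bochner_Integration.integrable_bound)
       (auto intro!: AE_I2 norm_lincomb_powr_le[OF assms(3), THEN order_trans])
  then show ?thesis by (simp add: Lp_space_def)
qed

lemma Lp_space_diff:
  fixes f g :: "'a \<Rightarrow> 'k::{real_normed_field, euclidean_space}"
  assumes "f \<in> Lp_space M p" "g \<in> Lp_space M p" "0 \<le> p"
  shows "(\<lambda>x. f x - g x) \<in> Lp_space M p"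
  using Lp_space_lincomb[OF assms, of 1 "-1"] by simp

lemma nn_integral_norm_powr:
  assumes "f \<in> Lp_space M p"
  shows "(\<integral>\<^sup>+ x. ennreal (norm (f x) powr p) \<partial>M) = ennreal (\<integral>x. norm (f x) powr p \<partial>M)"
  using assms by (intro nn_integral_eq_integral) (auto simp: Lp_space_def)

section \<open>Integrability and completeness over a finite measure\<close>

context finite_measure
begin

lemma Lp_space_imp_integrable:
  assumes "f \<in> Lp_space M p" "1 \<le> p"
  shows "integrable M f"
proof -
  have "integrable M (\<lambda>x. 1 + norm (f x) powr p)"
    using assms by (simp add: Lp_space_def)
  then show ?thesis
    using assms le_add_powr[of "norm (f _)" 1 p]
    by (intro Bochner_Integration.integrable_bound[of M "\<lambda>x. 1 + norm (f x) powr p" f])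
       (auto simp: Lp_space_def)
qed

text \<open>Used in place of Hoelder's inequality: a small \<open>c\<close> makes the first term
  small, after which small p-th moments take care of the second.\<close>

lemma integral_norm_le:
  assumes "f \<in> Lp_space M p" "1 \<le> p" "0 < c"
  shows "(\<integral>x. norm (f x) \<partial>M) \<le>
    c * measure M (space M) + c powr (1 - p) * (\<integral>x. norm (f x) powr p \<partial>M)"
proof -
  have int: "integrable M (\<lambda>x. norm (f x) powr p)" using assms by (simp add: Lp_space_def)
  have "(\<integral>x. norm (f x) \<partial>M) \<le> (\<integral>x. c + c powr (1 - p) * norm (f x) powr p \<partial>M)"
    using assms int Lp_space_imp_integrable[OF assms(1,2)]
    by (intro integral_mono le_add_powr) auto
  also have "\<dots> = c * measure M (space M) + c powr (1 - p) * (\<integral>x. norm (f x) powr p \<partial>M)"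
    using int by simp
  finally show ?thesis .
qed

text \<open>The sequence is also Cauchy in L^1, so a subsequence converges almost everywhere;
  Fatou's lemma along it bounds the distance from every late \<open>u n\<close> to the
  limit.\<close>

lemma Lp_complete:
  fixes u :: "nat \<Rightarrow> 'a \<Rightarrow> 'k::{real_normed_field, euclidean_space}"
  assumes u: "\<And>n. u n \<in> Lp_space M p" and p: "1 \<le> p"
    and cauchy: "\<And>e. 0 < e \<Longrightarrow> \<exists>N. \<forall>m\<ge>N. \<forall>n\<ge>N. (\<integral>x. norm (u m x - u n x) powr p \<partial>M) < e"
  obtains g where "g \<in> Lp_space M p" "(\<lambda>n. \<integral>x. norm (u n x - g x) powr p \<partial>M) \<longlonglongrightarrow> 0"
proof -
  have [measurable]: "u n \<in> borel_measurable M" for n using u[of n] by (simp add: Lp_space_def)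
  have diff: "(\<lambda>x. u m x - u n x) \<in> Lp_space M p" for m n
    using u p by (intro Lp_space_diff) auto
  have "\<exists>N. \<forall>m\<ge>N. \<forall>n\<ge>N. (\<integral>x. norm (u m x - u n x) \<partial>M) < e" if e: "0 < e" for e
  proof -
    \<comment> \<open>Leaves less than half of \<open>e\<close> to the first term of
      \<open>integral_norm_le\<close>; the added 1 covers total mass 0.\<close>
    define c where "c = e / (2 * (measure M (space M) + 1))"
    have c: "0 < c" using e by (simp add: c_def add_nonneg_pos)
    have "0 < measure M (space M) + 1" by (simp add: add_nonneg_pos)
    then have "c * (measure M (space M) + 1) = e / 2" by (simp add: c_def field_simps)
    then have half: "c * measure M (space M) < e / 2" using c by (simp add: algebra_simps)
    obtain N where N: "\<And>m n. m \<ge> N \<Longrightarrow> n \<ge> N \<Longrightarrow>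
        (\<integral>x. norm (u m x - u n x) powr p \<partial>M) < e / 2 / c powr (1 - p)"
      using cauchy[of "e / 2 / c powr (1 - p)"] e c by auto
    have "(\<integral>x. norm (u m x - u n x) \<partial>M) < e" if "m \<ge> N" "n \<ge> N" for m n
      using integral_norm_le[OF diff p c, of m n] N[OF that] half c by (simp add: field_simps)
    then show ?thesis by blast
  qed
  then obtain r where r: "strict_mono r" "AE x in M. Cauchy (\<lambda>i. u (r i) x)"
    using cauchy_L1_AE_cauchy_subseq[of M u] Lp_space_imp_integrable[OF u p] by blast
  define g where "g x = lim (\<lambda>i. u (r i) x)" for x
  have [measurable]: "g \<in> borel_measurable M" unfolding g_def by measurable
  have conv: "AE x in M. (\<lambda>i. u (r i) x) \<longlonglongrightarrow> g x"
    using r(2) by eventually_elim (simp add: g_def Cauchy_convergent_iff convergent_LIMSEQ_iff)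
  have fatou: "(\<integral>\<^sup>+ x. ennreal (norm (u n x - g x) powr p) \<partial>M) \<le> ennreal e"
    if e: "0 < e" and N: "\<forall>m\<ge>N. \<forall>n\<ge>N. (\<integral>x. norm (u m x - u n x) powr p \<partial>M) < e" and n: "N \<le> n"
    for n N e
  proof -
    have "(\<integral>\<^sup>+ x. ennreal (norm (u n x - g x) powr p) \<partial>M) =
        (\<integral>\<^sup>+ x. liminf (\<lambda>i. ennreal (norm (u n x - u (r i) x) powr p)) \<partial>M)"
    proof (rule nn_integral_cong_AE)
      show "AE x in M. ennreal (norm (u n x - g x) powr p) =
          liminf (\<lambda>i. ennreal (norm (u n x - u (r i) x) powr p))"
        using conv
      proof eventually_elim
        fix x assume "(\<lambda>i. u (r i) x) \<longlonglongrightarrow> g x"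
        then have "(\<lambda>i. ennreal (norm (u n x - u (r i) x) powr p)) \<longlonglongrightarrow> ennreal (norm (u n x - g x) powr p)"
          using p by (intro tendsto_ennrealI tendsto_powr' tendsto_intros) auto
        from lim_imp_Liminf[OF sequentially_bot this] show "ennreal (norm (u n x - g x) powr p) =
            liminf (\<lambda>i. ennreal (norm (u n x - u (r i) x) powr p))"
          by (rule sym)
      qed
    qed
    also have "\<dots> \<le> liminf (\<lambda>i. \<integral>\<^sup>+ x. ennreal (norm (u n x - u (r i) x) powr p) \<partial>M)"
      by (rule nn_integral_liminf) measurable
    also have "\<dots> \<le> liminf (\<lambda>i. ennreal e)"
    proof (rule Liminf_mono)
      show "\<forall>\<^sub>F i in sequentially. (\<integral>\<^sup>+ x. ennreal (norm (u n x - u (r i) x) powr p) \<partial>M) \<le> ennreal e"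
        using eventually_ge_at_top[of N]
      proof eventually_elim
        case (elim i)
        then have "N \<le> r i" using seq_suble[OF r(1), of i] by simp
        then show ?case
          using N n by (simp add: nn_integral_norm_powr[OF diff] ennreal_leI less_imp_le)
      qed
    qed
    also have "\<dots> = ennreal e" by (simp add: Liminf_const)
    finally show ?thesis .
  qed
  have int: "integrable M (\<lambda>x. norm (u n x - g x) powr p)" and
    le: "(\<integral>x. norm (u n x - g x) powr p \<partial>M) \<le> e"
    if e: "0 < e" and N: "\<forall>m\<ge>N. \<forall>n\<ge>N. (\<integral>x. norm (u m x - u n x) powr p \<partial>M) < e" and n: "N \<le> n"
    for n N e
  proof -
    have *: "(\<integral>\<^sup>+ x. ennreal (norm (u n x - g x) powr p) \<partial>M) \<le> ennreal e" by (rule fatou[OF that])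
    then have "(\<integral>\<^sup>+ x. ennreal (norm (u n x - g x) powr p) \<partial>M) < \<infinity>"
      by (rule le_less_trans) simp
    then show int: "integrable M (\<lambda>x. norm (u n x - g x) powr p)"
      by (intro integrableI_nonneg) auto
    show "(\<integral>x. norm (u n x - g x) powr p \<partial>M) \<le> e"
      using * e by (subst (asm) nn_integral_eq_integral[OF int]) (auto simp: ennreal_le_iff)
  qed
  obtain N where N: "\<forall>m\<ge>N. \<forall>n\<ge>N. (\<integral>x. norm (u m x - u n x) powr p \<partial>M) < 1"
    using cauchy[of 1] by auto
  have "(\<lambda>x. u N x - g x) \<in> Lp_space M p"
    using int[OF _ N] by (simp add: Lp_space_def)
  \<comment> \<open>\<open>g\<close> is recovered as \<open>u N\<close> minus the difference
    \<open>u N - g\<close>.\<close>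
  from Lp_space_diff[OF u[of N] this] p have "g \<in> Lp_space M p" by simp
  moreover have "(\<lambda>n. \<integral>x. norm (u n x - g x) powr p \<partial>M) \<longlonglongrightarrow> 0"
  proof (rule LIMSEQ_I)
    fix e :: real assume "0 < e"
    then have e: "0 < e / 2" by simp
    obtain N where N: "\<forall>m\<ge>N. \<forall>n\<ge>N. (\<integral>x. norm (u m x - u n x) powr p \<partial>M) < e / 2"
      using cauchy[OF e] by auto
    have "norm ((\<integral>x. norm (u n x - g x) powr p \<partial>M) - 0) < e" if "N \<le> n" for n
      using le[OF e N that] \<open>0 < e\<close> by simp
    then show "\<exists>N. \<forall>n\<ge>N. norm ((\<integral>x. norm (u n x - g x) powr p \<partial>M) - 0) < e" by blast
  qed
  ultimately show ?thesis by (rule that)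
qed

end

lemma convergent_diagonal_subseq:
  fixes a :: "'i \<Rightarrow> nat \<Rightarrow> 'b::heine_borel"
  assumes "countable I" and bdd: "\<And>i. i \<in> I \<Longrightarrow> bounded (range (a i))"
  obtains r where "strict_mono r" "\<And>i. i \<in> I \<Longrightarrow> convergent (\<lambda>n. a i (r n))"
proof (cases "I = {}")
  case True
  then show ?thesis using that[of id] by (simp add: strict_mono_id)
next
  case False
  let ?e = "from_nat_into I"
  have e: "?e k \<in> I" for k using False by (rule from_nat_into)
  interpret subseqs "\<lambda>k s. convergent (\<lambda>n. a (?e k) (s n))"
  proof
    fix k and s :: "nat \<Rightarrow> nat" assume "strict_mono s"
    have "bounded (range (\<lambda>n. a (?e k) (s n)))"
      by (rule bounded_subset[OF bdd[OF e]]) auto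
    from bounded_imp_convergent_subsequence[OF this]
    show "\<exists>r. strict_mono r \<and> convergent (\<lambda>n. a (?e k) ((s \<circ> r) n))"
      by (auto simp: convergent_def o_def)
  qed
  have "convergent (\<lambda>n. a i (diagseq n))" if i: "i \<in> I" for i
  proof -
    obtain k where k: "?e k = i"
      using from_nat_into_surj[OF \<open>countable I\<close> i] by blast
    \<comment> \<open>The diagonal sequence is controlled at stage \<open>k\<close> only beyond its
      first \<open>Suc k\<close> terms; dropping these does not affect convergence.\<close>
    have "convergent (\<lambda>n. a (?e k) ((diagseq \<circ> (+) (Suc k)) n))"
      by (rule diagseq_holds) (auto simp: o_def dest: convergent_subseq_convergent)
    then have "convergent (\<lambda>n. a i (diagseq (n + Suc k)))"
      by (simp add: k o_def add.commute)
    then show ?thesis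
      by (rule iffD1[OF convergent_ignore_initial_segment])
  qed
  then show ?thesis using subseq_diagseq by (rule that[rotated])
qed

section \<open>The logarithmic energy on a metric measure space\<close>

text \<open>The surviving terms are powers of two up to \<open>t\<close>, and their geometric sum is
  less than twice the largest. It serves to bound a weighted sum over nested balls by the
  kernel.\<close>

lemma sum_powers_of_two_le:
  fixes t :: real
  assumes "0 \<le> t"
  shows "(\<Sum>i<n. if 2 ^ i \<le> t then 2 ^ i else 0) \<le> 2 * t"
proof (induction n)
  case (Suc n)
  show ?case
  proof (cases "2 ^ n \<le> t")
    case True
    have "(\<Sum>i<Suc n. if 2 ^ i \<le> t then 2 ^ i else 0) \<le> (\<Sum>i<Suc n. (2::real) ^ i)"
      by (intro sum_mono) auto
    also have "\<dots> = 2 ^ Suc n - 1" by (subst geometric_sum) auto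
    finally show ?thesis using True by simp
  qed (use Suc in simp)
qed (use assms in simp)

text \<open>The boundary enters only as a metric space with a finite Borel measure; bounds on the
  mass of balls are hypotheses of the individual lemmas. The sigma-algebra is given in the form that
  \<open>measure_of\<close> produces.\<close>

locale metric_measure = Metric_space Z d + finite_measure \<nu>
  for Z :: "'a set" and d :: "'a \<Rightarrow> 'a \<Rightarrow> real" and \<nu> :: "'a measure" +
  assumes sets_borel: "sets \<nu> = sigma_sets Z {U. openin mtopology U}"
begin

lemma space_borel: "space \<nu> = Z"
proof -
  have "{U. openin mtopology U} \<subseteq> Pow Z" using openin_subset by fastforce
  then have "sets \<nu> = sets (sigma Z {U. openin mtopology U})" by (simp add: sets_borel)
  from sets_eq_imp_space_eq[OF this] show ?thesis by (simp add: space_measure_of_conv)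
qed

lemma mball_measurable [measurable]: "mball x r \<in> sets \<nu>"
  by (auto simp: sets_borel)

lemma measurable_dist_left:
  assumes "x \<in> Z"
  shows "(\<lambda>y. d x y) \<in> borel_measurable \<nu>"
proof (rule borel_measurableI_less)
  fix r
  have "{y \<in> space \<nu>. d x y < r} = mball x r" using assms by (auto simp: space_borel)
  then show "{y \<in> space \<nu>. d x y < r} \<in> sets \<nu>" by simp
qed

lemma cball_measurable:
  assumes "x \<in> Z"
  shows "{y \<in> Z. d x y \<le> r} \<in> sets \<nu>"
proof -
  have "{y \<in> space \<nu>. d x y \<le> r} \<in> sets \<nu>"
    using measurable_dist_left[OF assms] by measurable
  then show ?thesis by (simp add: space_borel)
qed

text \<open>A maximal \<open>e\<close>-separated set is an \<open>e\<close>-net. It is finite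
  because the balls of radius \<open>r\<close> around its points are disjoint and each has mass at
  least \<open>m\<close>, while the total mass is finite.\<close>

lemma mtotally_bounded_if_lower_regular:
  assumes "0 < \<Delta>" "0 < c"
    and lower: "\<And>x r. x \<in> Z \<Longrightarrow> 0 \<le> r \<Longrightarrow> r \<le> \<Delta> \<Longrightarrow>
      ennreal (c * r powr D) \<le> emeasure \<nu> {y \<in> Z. d x y \<le> r}"
  shows "mtotally_bounded Z"
  unfolding mtotally_bounded_def
proof (intro allI impI)
  fix e :: real assume "0 < e"
  \<comment> \<open>Less than \<open>e / 2\<close>, so that balls around \<open>e\<close>-separated
    centres are disjoint, and at most \<Delta>, so that the mass bound applies.\<close>
  define r where "r = min (e / 3) \<Delta>"
  have r: "0 < r" "r \<le> \<Delta>" "2 * r < e" using \<open>0 < e\<close> \<open>0 < \<Delta>\<close> by (auto simp: r_def min_def)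
  define m where "m = c * r powr D"
  have m: "0 < m" using r \<open>0 < c\<close> by (simp add: m_def)
  define P where "P T \<longleftrightarrow> finite T \<and> T \<subseteq> Z \<and> (\<forall>x\<in>T. \<forall>y\<in>T. x \<noteq> y \<longrightarrow> e \<le> d x y)" for T
  have card_le: "card T \<le> nat \<lceil>measure \<nu> Z / m\<rceil>" if "P T" for T
  proof -
    let ?B = "\<lambda>x. {y \<in> Z. d x y \<le> r}"
    have T: "finite T" "T \<subseteq> Z" using that by (auto simp: P_def)
    have "disjoint_family_on ?B T"
      unfolding disjoint_family_on_def
    proof (intro ballI impI, rule ccontr)
      fix x x' assume x: "x \<in> T" "x' \<in> T" "x \<noteq> x'" and "?B x \<inter> ?B x' \<noteq> {}"
      then obtain y where y: "y \<in> Z" "d x y \<le> r" "d x' y \<le> r" by auto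
      have "d x x' \<le> d x y + d y x'" using x y T by (intro triangle) auto
      moreover have "e \<le> d x x'" using that x by (auto simp: P_def)
      ultimately show False using y r commute[of y x'] by linarith
    qed
    then have "(\<Sum>x\<in>T. measure \<nu> (?B x)) = measure \<nu> (\<Union>x\<in>T. ?B x)"
      using T cball_measurable by (intro finite_measure_finite_Union[symmetric]) auto
    also have "\<dots> \<le> measure \<nu> Z"
      using sets.top[of \<nu>] by (intro finite_measure_mono) (auto simp: space_borel)
    finally have "(\<Sum>x\<in>T. measure \<nu> (?B x)) \<le> measure \<nu> Z" .
    moreover have "m \<le> measure \<nu> (?B x)" if "x \<in> T" for x
      using lower[of x r] that T r m by (auto simp: emeasure_eq_measure ennreal_le_iff m_def)
    then have "(\<Sum>x\<in>T. m) \<le> (\<Sum>x\<in>T. measure \<nu> (?B x))" by (intro sum_mono)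
    ultimately have "real (card T) \<le> measure \<nu> Z / m" using m by (simp add: field_simps)
    then show ?thesis by linarith
  qed
  have "P {}" by (simp add: P_def)
  then obtain T where T: "P T" "\<And>T'. P T' \<Longrightarrow> card T' \<le> card T"
    using ex_has_greatest_nat[of P "{}" card] card_le by (metis less_Suc_eq_le)
  have "Z \<subseteq> (\<Union>x\<in>T. mball x e)"
  proof
    fix y assume y: "y \<in> Z"
    show "y \<in> (\<Union>x\<in>T. mball x e)"
    proof (rule ccontr)
      assume "y \<notin> (\<Union>x\<in>T. mball x e)"
      then have *: "e \<le> d x y" "e \<le> d y x" if "x \<in> T" for x
        using that T(1) y commute[of x y] by (auto simp: P_def subset_iff not_less)
      then have "y \<notin> T" using \<open>0 < e\<close> y by force
      have "P (insert y T)" using T(1) * y by (auto simp: P_def)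
      from T(2)[OF this] show False using \<open>y \<notin> T\<close> T(1) by (simp add: P_def)
    qed
  qed
  then show "\<exists>K. finite K \<and> K \<subseteq> Z \<and> Z \<subseteq> (\<Union>x\<in>K. mball x e)"
    using T(1) by (auto simp: P_def)
qed

text \<open>The kernel \<open>1 / d(x,y)\<^sup>D\<close> fails to be integrable, uniformly in \<open>x\<close>: each of the balls
  of radius \<open>r\<close> with \<open>r\<^sup>D = \<Delta>\<^sup>D / 2\<^sup>i\<close> contributes at least a constant to its integral.\<close>

lemma log_kernel_diverges:
  assumes "0 < \<Delta>" "0 < c" "0 < D"
    and lower: "\<And>x r. x \<in> Z \<Longrightarrow> 0 \<le> r \<Longrightarrow> r \<le> \<Delta> \<Longrightarrow>
      ennreal (c * r powr D) \<le> emeasure \<nu> {y \<in> Z. d x y \<le> r}"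
  shows "\<exists>\<delta>>0. \<forall>x\<in>Z. ennreal L \<le> (\<integral>\<^sup>+ y. ennreal (1 / (d x y + 2 * \<delta>) powr D) \<partial>\<nu>)"
proof -
  define r where "r i = 2 powr (- real i / D) * \<Delta>" for i
  have r_pos: "0 < r i" for i using \<open>0 < \<Delta>\<close> by (simp add: r_def)
  have r_le: "r i \<le> r j" if "j \<le> i" for i j
    using that \<open>0 < \<Delta>\<close> \<open>0 < D\<close> unfolding r_def
    by (intro mult_right_mono powr_mono) (auto simp: divide_right_mono)
  have r_powr: "r i powr D = \<Delta> powr D / 2 ^ i" for i
  proof -
    have "(2 powr (- real i / D)) powr D = inverse (2 ^ i)"
      using \<open>0 < D\<close> powr_minus[of 2 "real i"] by (simp add: powr_powr powr_realpow)
    then show ?thesis using \<open>0 < \<Delta>\<close> by (simp add: r_def powr_mult field_simps)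
  qed
  \<comment> \<open>The constant \<open>b\<close> below equals
    \<open>a * (c * \<Delta> powr D)\<close>, so with \<open>L * a \<le> n\<close> the
    \<open>n\<close> contributions \<open>c * \<Delta> powr D\<close> add up to at least
    \<open>L * b\<close>.\<close>
  define a where "a = 2 * 2 powr D / c"
  have "0 < a" using \<open>0 < c\<close> by (simp add: a_def)
  obtain n :: nat where n: "L * a \<le> real n" using real_arch_simple by blast
  \<comment> \<open>Then \<open>2 * \<delta> = r n\<close> is at most \<open>r i\<close> for
    \<open>i < n\<close>: on the ball of radius \<open>r i\<close> the regularised distance is at
    most \<open>2 * r i\<close>.\<close>
  define \<delta> where "\<delta> = r n / 2"
  have "0 < \<delta>" using r_pos by (simp add: \<delta>_def)
  have "ennreal L \<le> (\<integral>\<^sup>+ y. ennreal (1 / (d x y + 2 * \<delta>) powr D) \<partial>\<nu>)" if x: "x \<in> Z" for x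
  proof -
    have [measurable]: "(\<lambda>y. d x y) \<in> borel_measurable \<nu>" by (rule measurable_dist_left[OF x])
    let ?B = "\<lambda>i. {y \<in> Z. d x y \<le> r i}"
    have [measurable]: "?B i \<in> sets \<nu>" for i by (rule cball_measurable[OF x])
    define b where "b = 2 * (2 * \<Delta>) powr D"
    have "0 < b" using \<open>0 < \<Delta>\<close> by (simp add: b_def)
    \<comment> \<open>The numbers \<open>2 ^ i\<close> belonging to balls that contain
      \<open>y\<close> are all at most \<open>t\<close>, hence sum to at most
      \<open>2 * t\<close>.\<close>
    have pw: "(\<Sum>i<n. ennreal (2 ^ i) * indicator (?B i) y)
        \<le> ennreal b * ennreal (1 / (d x y + 2 * \<delta>) powr D)" for y
    proof -
      define t where "t = (2 * \<Delta>) powr D / (d x y + 2 * \<delta>) powr D"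
      have s_pos: "0 < d x y + 2 * \<delta>" using \<open>0 < \<delta>\<close> by (simp add: add_nonneg_pos)
      have t: "2 ^ i \<le> t" if "y \<in> ?B i" "i < n" for i
      proof -
        have "d x y + 2 * \<delta> \<le> 2 * r i"
          using that r_le[of i n] by (simp add: \<delta>_def)
        then have "(d x y + 2 * \<delta>) powr D \<le> (2 * r i) powr D"
          using s_pos \<open>0 < D\<close> by (intro powr_mono2) auto
        also have "\<dots> = (2 * \<Delta>) powr D / 2 ^ i"
          using r_pos[of i] \<open>0 < \<Delta>\<close> by (simp add: powr_mult r_powr)
        finally show ?thesis using s_pos by (simp add: t_def field_simps)
      qed
      have "(\<Sum>i<n. 2 ^ i * indicator (?B i) y) \<le> (\<Sum>i<n. if 2 ^ i \<le> t then (2::real) ^ i else 0)"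
        by (intro sum_mono) (use t in \<open>auto simp: indicator_def\<close>)
      also have "\<dots> \<le> 2 * t" by (rule sum_powers_of_two_le) (simp add: t_def)
      finally have "ennreal (\<Sum>i<n. 2 ^ i * indicator (?B i) y) \<le> ennreal (2 * t)"
        by (rule ennreal_leI)
      also have "2 * t = b * (1 / (d x y + 2 * \<delta>) powr D)" by (simp add: t_def b_def)
      also have "ennreal \<dots> = ennreal b * ennreal (1 / (d x y + 2 * \<delta>) powr D)"
        using \<open>0 < b\<close> by (intro ennreal_mult) auto
      finally show ?thesis
        by (simp add: ennreal_mult ennreal_indicator flip: sum_ennreal)
    qed
    \<comment> \<open>The weight \<open>2 ^ i\<close> times the lower mass bound of the i-th ball is
      \<open>c * \<Delta> powr D\<close>, the same for every \<open>i\<close>.\<close>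
    have "ennreal (real n * (c * \<Delta> powr D)) = (\<Sum>i<n. ennreal (2 ^ i) * ennreal (c * r i powr D))"
      using \<open>0 < c\<close> by (simp add: r_powr ennreal_mult ennreal_of_nat_eq_real_of_nat flip: ennreal_mult)
    also have "\<dots> \<le> (\<Sum>i<n. ennreal (2 ^ i) * emeasure \<nu> (?B i))"
    proof (intro sum_mono mult_left_mono lower x)
      show "r i \<le> \<Delta>" for i using r_le[of 0 i] by (simp add: r_def)
    qed (use r_pos in \<open>auto simp: less_imp_le\<close>)
    also have "\<dots> = (\<integral>\<^sup>+ y. (\<Sum>i<n. ennreal (2 ^ i) * indicator (?B i) y) \<partial>\<nu>)"
      by (subst nn_integral_sum) (auto simp: nn_integral_cmult_indicator)
    also have "\<dots> \<le> (\<integral>\<^sup>+ y. ennreal b * ennreal (1 / (d x y + 2 * \<delta>) powr D) \<partial>\<nu>)"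
      by (intro nn_integral_mono pw)
    also have "\<dots> = ennreal b * (\<integral>\<^sup>+ y. ennreal (1 / (d x y + 2 * \<delta>) powr D) \<partial>\<nu>)"
      by (intro nn_integral_cmult) measurable
    finally have *: "ennreal (real n * (c * \<Delta> powr D)) \<le>
        ennreal b * (\<integral>\<^sup>+ y. ennreal (1 / (d x y + 2 * \<delta>) powr D) \<partial>\<nu>)" .
    have "L * b \<le> real n * (c * \<Delta> powr D)"
      using mult_right_mono[OF n, of "c * \<Delta> powr D"] \<open>0 < c\<close> \<open>0 < \<Delta>\<close>
      by (simp add: a_def b_def powr_mult field_simps)
    then have "ennreal (L * b) \<le> ennreal (real n * (c * \<Delta> powr D))" by (rule ennreal_leI)
    moreover have "ennreal (L * b) = ennreal b * ennreal L"
      using ennreal_mult'[of b L] \<open>0 < b\<close> by (simp add: mult.commute[of L])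
    ultimately have "ennreal b * ennreal L \<le> ennreal (real n * (c * \<Delta> powr D))"
      by (simp only:)
    also note *
    finally show ?thesis
      using \<open>0 < b\<close> by (subst (asm) ennreal_mult_le_mult_iff) auto
  qed
  then show ?thesis using \<open>0 < \<delta>\<close> by blast
qed

section \<open>Measurability and linearity on totally bounded spaces\<close>

context
  assumes tot: "mtotally_bounded Z"
begin

text \<open>Total boundedness gives a countable dense set \<open>Q\<close>, and \<open>d x y\<close>
  is the infimum of \<open>d q x + d q y\<close> over \<open>q\<close> in \<open>Q\<close>, each sum
  being measurable on the product. The inner integrals of the energy need this joint
  measurability.\<close>

lemma measurable_dist_Pair: "(\<lambda>z. d (fst z) (snd z)) \<in> borel_measurable (\<nu> \<Otimes>\<^sub>M \<nu>)"
proof -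
  have "\<forall>n. \<exists>K. finite K \<and> K \<subseteq> Z \<and> Z \<subseteq> (\<Union>x\<in>K. mball x (1 / real (Suc n)))"
    using tot by (auto simp: mtotally_bounded_def)
  then obtain K where K: "\<And>n. finite (K n)" "\<And>n. K n \<subseteq> Z"
      "\<And>n. Z \<subseteq> (\<Union>x\<in>K n. mball x (1 / real (Suc n)))" by metis
  define Q where "Q = (\<Union>n. K n)"
  have Q: "countable Q" "Q \<subseteq> Z" using K by (auto simp: Q_def countable_finite)
  have dense: "\<exists>q\<in>Q. d q x < e" if "0 < e" "x \<in> Z" for e x
  proof -
    obtain n where "1 / real (Suc n) < e" using nat_approx_posE[OF \<open>0 < e\<close>] by blast
    moreover obtain q where "q \<in> K n" "d q x < 1 / real (Suc n)"
      using K(3)[of n] \<open>x \<in> Z\<close> by auto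
    ultimately show ?thesis by (auto simp: Q_def intro!: bexI[of _ q])
  qed
  have "(\<lambda>z. INF q\<in>Q. d q (fst z) + d q (snd z)) \<in> borel_measurable (\<nu> \<Otimes>\<^sub>M \<nu>)"
  proof (rule borel_measurable_cINF[OF Q(1)])
    fix q assume "q \<in> Q"
    then have [measurable]: "(\<lambda>y. d q y) \<in> borel_measurable \<nu>"
      using Q measurable_dist_left by blast
    show "(\<lambda>z. d q (fst z) + d q (snd z)) \<in> borel_measurable (\<nu> \<Otimes>\<^sub>M \<nu>)" by measurable
  next
    fix z show "bdd_below ((\<lambda>q. d q (fst z) + d q (snd z)) ` Q)"
      by (rule bdd_belowI2[of _ 0]) auto
  qed
  also have "?this \<longleftrightarrow> ?thesis"
  proof (rule measurable_cong)
    fix z assume "z \<in> space (\<nu> \<Otimes>\<^sub>M \<nu>)"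
    then obtain x y where z: "z = (x, y)" "x \<in> Z" "y \<in> Z"
      by (auto simp: space_pair_measure space_borel)
    have "(INF q\<in>Q. d q x + d q y) \<le> d x y + e" if e: "0 < e" for e
    proof -
      obtain q where q: "q \<in> Q" "d q x < e / 2" using dense[of "e / 2" x] e z by auto
      have "(INF q\<in>Q. d q x + d q y) \<le> d q x + d q y"
        using q by (intro cINF_lower bdd_belowI2[of _ 0]) auto
      also have "d q y \<le> d q x + d x y" using q Q z by (intro triangle) auto
      finally show ?thesis using q by simp
    qed
    then have "(INF q\<in>Q. d q x + d q y) \<le> d x y" by (rule field_le_epsilon)
    moreover have "d x y \<le> (INF q\<in>Q. d q x + d q y)"
    proof (rule cINF_greatest)
      show "Q \<noteq> {}" using dense[of 1 x] z by auto
      show "d x y \<le> d q x + d q y" if "q \<in> Q" for q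
        using triangle[of x q y] commute[of x q] that Q z by auto
    qed
    ultimately show "(INF q\<in>Q. d q (fst z) + d q (snd z)) = d (fst z) (snd z)"
      by (simp add: z(1))
  qed
  finally show ?thesis .
qed

lemma measurable_dist [measurable (raw)]:
  assumes "f \<in> measurable N \<nu>" "g \<in> measurable N \<nu>"
  shows "(\<lambda>x. d (f x) (g x)) \<in> borel_measurable N"
  using measurable_compose[OF measurable_Pair[OF assms] measurable_dist_Pair] by simp

lemma log_energy_lincomb:
  fixes f g :: "'a \<Rightarrow> 'k::{real_normed_field, euclidean_space}"
  assumes [measurable]: "f \<in> borel_measurable \<nu>" "g \<in> borel_measurable \<nu>" and "0 \<le> p"
  shows "log_energy d \<nu> D p (\<lambda>x. a * f x + b * g x) \<le>
    ennreal (2 powr p * norm a powr p) * log_energy d \<nu> D p f +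
    ennreal (2 powr p * norm b powr p) * log_energy d \<nu> D p g"
proof -
  let ?e = "\<lambda>h x y. ennreal (norm (h x - h y :: 'k) powr p / d x y powr D)"
  let ?a = "2 powr p * norm a powr p" and ?b = "2 powr p * norm b powr p"
  have pw: "?e (\<lambda>x. a * f x + b * g x) x y \<le> ennreal ?a * ?e f x y + ennreal ?b * ?e g x y" for x y
  proof -
    have "norm (a * f x + b * g x - (a * f y + b * g y)) powr p
        \<le> ?a * norm (f x - f y) powr p + ?b * norm (g x - g y) powr p"
      using norm_lincomb_powr_le[OF \<open>0 \<le> p\<close>, of a "f x - f y" b "g x - g y"]
      by (simp add: algebra_simps)
    then have "norm (a * f x + b * g x - (a * f y + b * g y)) powr p / d x y powr D
        \<le> (?a * norm (f x - f y) powr p + ?b * norm (g x - g y) powr p) / d x y powr D"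
      by (rule divide_right_mono) simp
    then show ?thesis
      by (simp add: add_divide_distrib ennreal_leI flip: ennreal_mult' ennreal_plus)
  qed
  have "log_energy d \<nu> D p (\<lambda>x. a * f x + b * g x) \<le>
      (\<integral>\<^sup>+ x. (\<integral>\<^sup>+ y. ennreal ?a * ?e f x y + ennreal ?b * ?e g x y \<partial>\<nu>) \<partial>\<nu>)"
    unfolding log_energy_def by (intro nn_integral_mono pw)
  also have "\<dots> = (\<integral>\<^sup>+ x. ennreal ?a * (\<integral>\<^sup>+ y. ?e f x y \<partial>\<nu>) + ennreal ?b * (\<integral>\<^sup>+ y. ?e g x y \<partial>\<nu>) \<partial>\<nu>)"
    by (intro nn_integral_cong, subst nn_integral_add) (simp_all add: nn_integral_cmult)
  also have "\<dots> = ennreal ?a * log_energy d \<nu> D p f + ennreal ?b * log_energy d \<nu> D p g"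
    unfolding log_energy_def by (subst nn_integral_add) (simp_all add: nn_integral_cmult)
  finally show ?thesis .
qed

lemma Wlog_space_lincomb:
  fixes f g :: "'a \<Rightarrow> 'k::{real_normed_field, euclidean_space}"
  assumes "f \<in> Wlog_space d \<nu> D p" "g \<in> Wlog_space d \<nu> D p" "0 \<le> p"
  shows "(\<lambda>x. a * f x + b * g x) \<in> Wlog_space d \<nu> D p"
proof -
  have fg: "f \<in> Lp_space \<nu> p" "g \<in> Lp_space \<nu> p"
    "log_energy d \<nu> D p f < \<infinity>" "log_energy d \<nu> D p g < \<infinity>"
    using assms by (auto simp: Wlog_space_def)
  have "log_energy d \<nu> D p (\<lambda>x. a * f x + b * g x) \<le>
      ennreal (2 powr p * norm a powr p) * log_energy d \<nu> D p f +
      ennreal (2 powr p * norm b powr p) * log_energy d \<nu> D p g"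
    using fg assms by (intro log_energy_lincomb) (auto simp: Lp_space_def)
  also have "\<dots> < \<infinity>" using fg by (simp add: ennreal_mult_less_top)
  finally show ?thesis using Lp_space_lincomb[OF fg(1,2) assms(3)] by (simp add: Wlog_space_def)
qed

section \<open>Finite-rank averaging and an Ehrling inequality\<close>

lemma small_partition:
  assumes "0 < \<delta>"
  obtains N :: nat and z A where "\<And>j. j < N \<Longrightarrow> z j \<in> Z" "\<And>j. j < N \<Longrightarrow> A j \<in> sets \<nu>"
    "disjoint_family_on A {..<N}" "(\<Union>j<N. A j) = Z" "\<And>j y. y \<in> A j \<Longrightarrow> d (z j) y < \<delta>"
proof -
  obtain K where K: "finite K" "K \<subseteq> Z" "Z \<subseteq> (\<Union>x\<in>K. mball x \<delta>)"
    using tot assms by (auto simp: mtotally_bounded_def)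
  obtain N and z :: "nat \<Rightarrow> 'a" where z: "K = z ` {i. i < N}"
    using finite_imp_nat_seg_image_inj_on[OF K(1)] by blast
  define A where "A = disjointed (\<lambda>i. mball (z i) \<delta>)"
  have "(\<Union>j<N. A j) = (\<Union>j<N. mball (z j) \<delta>)"
    using finite_UN_disjointed_eq[of "\<lambda>i. mball (z i) \<delta>" N] by (simp add: A_def atLeast0LessThan)
  moreover have "(\<Union>j<N. mball (z j) \<delta>) = Z"
    using K z mball_subset_mspace by auto
  moreover have "A j \<in> sets \<nu>" for j
    unfolding A_def disjointed_def by measurable
  moreover have "disjoint_family_on A {..<N}"
    using disjoint_family_disjointed[of "\<lambda>i. mball (z i) \<delta>"]
    by (auto simp: A_def disjoint_family_on_def)
  moreover have "d (z j) y < \<delta>" if "y \<in> A j" for j y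
    using that disjointed_subset[of "\<lambda>i. mball (z i) \<delta>" j] by (auto simp: A_def)
  ultimately show ?thesis using K z by (intro that[of N z A]) auto
qed

text \<open>Averaging with the step kernel \<open>w j = 1 / (d(x,z\<^sub>j) + \<delta>)\<^sup>D\<close> on \<open>A j\<close>, which is dominated
  by \<open>1 / d(x,y)\<^sup>D\<close> but has mass at least \<open>L\<close>.\<close>

lemma norm_powr_le_energy_density:
  fixes f :: "'a \<Rightarrow> 'k::{real_normed_field, euclidean_space}" and A :: "nat \<Rightarrow> 'a set"
  assumes x: "x \<in> Z" and f: "f \<in> Lp_space \<nu> p" and p: "1 \<le> p" and D: "0 \<le> D"
    and \<delta>: "0 < \<delta>" and L: "0 < L"
    and mass: "ennreal L \<le> (\<integral>\<^sup>+ y. ennreal (1 / (d x y + 2 * \<delta>) powr D) \<partial>\<nu>)"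
    and z: "\<And>j. j < N \<Longrightarrow> z j \<in> Z" and A: "\<And>j. j < N \<Longrightarrow> A j \<in> sets \<nu>"
    and disj: "disjoint_family_on A {..<N}" and cover: "(\<Union>j<N. A j) = Z"
    and small: "\<And>j y. y \<in> A j \<Longrightarrow> d (z j) y < \<delta>"
  shows "ennreal (norm (f x) powr p) \<le>
    ennreal (2 powr p * 2 powr p / L) *
      (\<integral>\<^sup>+ y. ennreal (norm (f x - f y) powr p / d x y powr D) \<partial>\<nu>) +
    ennreal ((2 / (\<delta> powr D * L) * (\<Sum>j<N. norm (LINT y:A j|\<nu>. f y))) powr p)"
\<comment> \<open>An infinite energy density makes the right-hand side infinite; a finite one makes
  the weighted p-th powers integrable.\<close>
proof (cases "(\<integral>\<^sup>+ y. ennreal (norm (f x - f y) powr p / d x y powr D) \<partial>\<nu>) = \<infinity>")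
  case True
  then show ?thesis using L by (simp add: ennreal_mult_top)
next
  case False
  define I where "I = (\<integral>\<^sup>+ y. ennreal (norm (f x - f y) powr p / d x y powr D) \<partial>\<nu>)"
  define S where "S = (\<Sum>j<N. norm (LINT y:A j|\<nu>. f y))"
  \<comment> \<open>On \<open>A j\<close> the triangle inequality gives
    \<open>d x y \<le> d x (z j) + \<delta> \<le> d x y + 2 * \<delta>\<close>, so for
    \<open>y\<close> other than \<open>x\<close> the step kernel lies between the regularised and
    the singular kernel.\<close>
  define w where "w j = 1 / (d x (z j) + \<delta>) powr D" for j
  define k where "k y = (\<Sum>j<N. w j * indicator (A j) y)" for y
  define K where "K = (\<integral>y. k y \<partial>\<nu>)"
  have "0 \<le> S" by (simp add: S_def sum_nonneg)
  have w_nonneg: "0 \<le> w j" for j by (simp add: w_def)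
  have w_le: "w j \<le> 1 / \<delta> powr D" for j
  proof -
    have "\<delta> powr D \<le> (d x (z j) + \<delta>) powr D" using \<delta> D by (intro powr_mono2) auto
    then show ?thesis using \<delta> by (simp add: w_def frac_le)
  qed
  have k_nonneg: "0 \<le> k y" for y by (simp add: k_def w_nonneg sum_nonneg)
  have k_eq: "\<exists>j<N. y \<in> A j \<and> k y = w j" if y: "y \<in> Z" for y
  proof -
    obtain j where j: "j < N" "y \<in> A j" using y cover by auto
    then have "k y = w j"
      unfolding k_def by (intro sum_indicator_disjoint_family[OF disj j(2)]) auto
    then show ?thesis using j by blast
  qed
  have [measurable]: "f \<in> borel_measurable \<nu>" using f by (simp add: Lp_space_def)
  have [measurable]: "(\<lambda>y. d x y) \<in> borel_measurable \<nu>" by (rule measurable_dist_left[OF x])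
  have k_meas [measurable]: "k \<in> borel_measurable \<nu>"
    unfolding k_def using A by (intro borel_measurable_sum) auto
  have f_int: "integrable \<nu> f" by (rule Lp_space_imp_integrable[OF f p])
  have k_int: "integrable \<nu> k"
    unfolding k_def using A
    by (intro Bochner_Integration.integrable_sum integrable_mult_right) (auto simp: less_top[symmetric])
  have Af_int: "integrable \<nu> (\<lambda>y. w j *\<^sub>R (indicator (A j) y *\<^sub>R f y))" if "j < N" for j
    by (intro integrable_scaleR_right integrable_mult_indicator A that f_int)
  have kf: "k y *\<^sub>R f y = (\<Sum>j<N. w j *\<^sub>R (indicator (A j) y *\<^sub>R f y))" for y
    by (simp only: k_def scaleR_sum_left scaleR_scaleR)
  have kf_int: "integrable \<nu> (\<lambda>y. k y *\<^sub>R f y)"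
    unfolding kf using Af_int by (intro Bochner_Integration.integrable_sum) auto
  have kd_int: "integrable \<nu> (\<lambda>y. k y *\<^sub>R (f x - f y))"
    unfolding scaleR_diff_right using k_int kf_int
    by (intro Bochner_Integration.integrable_diff integrable_scaleR_left) auto
  define T where "T = (\<integral>y. k y * norm (f x - f y) \<partial>\<nu>)"
  have kt_int: "integrable \<nu> (\<lambda>y. k y * norm (f x - f y))"
    using integrable_norm[OF kd_int] k_nonneg by simp
  \<comment> \<open>Writing \<open>f x\<close> as \<open>(f x - f y) + f y\<close> under the
    integral against \<open>k\<close> separates a part controlled by the energy from one that sees
    only the integrals of \<open>f\<close> over the sets \<open>A j\<close>.\<close>
  have "norm (K *\<^sub>R f x) \<le> T + S / \<delta> powr D"
  proof -
    have "K *\<^sub>R f x = (\<integral>y. k y *\<^sub>R (f x - f y) + k y *\<^sub>R f y \<partial>\<nu>)"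
      using k_int by (simp add: K_def flip: scaleR_add_right)
    also have "\<dots> = (\<integral>y. k y *\<^sub>R (f x - f y) \<partial>\<nu>) + (\<integral>y. k y *\<^sub>R f y \<partial>\<nu>)"
      by (rule Bochner_Integration.integral_add[OF kd_int kf_int])
    also have "norm \<dots> \<le> norm (\<integral>y. k y *\<^sub>R (f x - f y) \<partial>\<nu>) + norm (\<integral>y. k y *\<^sub>R f y \<partial>\<nu>)"
      by (rule norm_triangle_ineq)
    also have "norm (\<integral>y. k y *\<^sub>R (f x - f y) \<partial>\<nu>) \<le> T"
      using integral_norm_bound[of \<nu> "\<lambda>y. k y *\<^sub>R (f x - f y)"] k_nonneg by (simp add: T_def)
    also have "norm (\<integral>y. k y *\<^sub>R f y \<partial>\<nu>) \<le> S / \<delta> powr D"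
    proof -
      have "(\<integral>y. k y *\<^sub>R f y \<partial>\<nu>) = (\<Sum>j<N. \<integral>y. w j *\<^sub>R (indicator (A j) y *\<^sub>R f y) \<partial>\<nu>)"
        unfolding kf by (intro Bochner_Integration.integral_sum Af_int) simp
      also have "\<dots> = (\<Sum>j<N. w j *\<^sub>R (LINT y:A j|\<nu>. f y))"
        unfolding set_lebesgue_integral_def by (simp only: integral_scaleR_right)
      also have "norm \<dots> \<le> (\<Sum>j<N. norm (w j *\<^sub>R (LINT y:A j|\<nu>. f y)))" by (rule norm_sum)
      also have "\<dots> \<le> (\<Sum>j<N. 1 / \<delta> powr D * norm (LINT y:A j|\<nu>. f y))"
        using w_nonneg w_le by (intro sum_mono) (simp add: mult_right_mono del: times_divide_eq_left)
      also have "\<dots> = S / \<delta> powr D" by (simp add: S_def sum_distrib_left sum_divide_distrib)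
      finally show ?thesis .
    qed
    finally show ?thesis by simp
  qed
  moreover have "L \<le> K"
  proof -
    have "ennreal L \<le> (\<integral>\<^sup>+ y. ennreal (k y) \<partial>\<nu>)"
    proof (rule order_trans[OF mass nn_integral_mono])
      fix y assume "y \<in> space \<nu>"
      then have y: "y \<in> Z" by (simp add: space_borel)
      obtain j where j: "j < N" "y \<in> A j" "k y = w j" using k_eq[OF y] by blast
      have "d x (z j) \<le> d x y + d y (z j)" using x y z j by (intro triangle) auto
      then have "d x (z j) + \<delta> \<le> d x y + 2 * \<delta>" using small[OF j(2)] commute[of y "z j"] by simp
      then have "(d x (z j) + \<delta>) powr D \<le> (d x y + 2 * \<delta>) powr D"
        using \<delta> D by (intro powr_mono2) (auto intro: add_nonneg_nonneg)
      then show "ennreal (1 / (d x y + 2 * \<delta>) powr D) \<le> ennreal (k y)"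
        using \<delta> add_nonneg_pos[OF nonneg \<delta>, of x "z j"]
        by (intro ennreal_leI) (simp add: j(3) w_def frac_le)
    qed
    also have "\<dots> = ennreal K"
      unfolding K_def using k_int k_nonneg by (intro nn_integral_eq_integral) auto
    finally show ?thesis
      using k_nonneg by (subst (asm) ennreal_le_iff) (auto simp: K_def)
  qed
  ultimately have fx: "norm (f x) \<le> T / K + S / \<delta> powr D / K" and "0 < K"
    using L by (auto simp: field_simps)
  have pw: "k y * norm (f x - f y) powr p \<le> norm (f x - f y) powr p / d x y powr D" if y: "y \<in> Z" for y
  \<comment> \<open>On the diagonal both sides are 0, the right one through
    \<open>0 / 0 = 0\<close>.\<close>
  proof (cases "x = y")
    case False
    then have dxy: "0 < d x y" using x y by (simp add: order_le_neq_trans)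
    obtain j where j: "j < N" "y \<in> A j" "k y = w j" using k_eq[OF y] by blast
    have "d x y \<le> d x (z j) + d (z j) y" using x y z j by (intro triangle) auto
    then have "d x y powr D \<le> (d x (z j) + \<delta>) powr D"
      using small[OF j(2)] D by (intro powr_mono2) auto
    then have "k y \<le> 1 / d x y powr D" using dxy by (simp add: j(3) w_def frac_le)
    then show ?thesis by (metis mult_right_mono powr_ge_zero mult_1 times_divide_eq_left)
  qed simp
  define Q where "Q = (\<integral>y. k y * norm (f x - f y) powr p \<partial>\<nu>)"
  have le_I: "(\<integral>\<^sup>+ y. ennreal (k y * norm (f x - f y) powr p) \<partial>\<nu>) \<le> I"
    unfolding I_def by (intro nn_integral_mono ennreal_leI pw) (simp add: space_borel)
  have ktp_int: "integrable \<nu> (\<lambda>y. k y * norm (f x - f y) powr p)"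
    using le_I False k_nonneg by (intro integrableI_nonneg) (auto simp: I_def less_top top_unique)
  have "0 \<le> Q" unfolding Q_def by (simp add: k_nonneg)
  have Q_le: "ennreal Q \<le> I"
    using le_I nn_integral_eq_integral[OF ktp_int] k_nonneg by (simp add: Q_def)
  \<comment> \<open>The weak Jensen inequality for \<open>k\<close>; afterwards \<open>K\<close>
    gives way to its lower bound \<open>L\<close>.\<close>
  have "(T / K) powr p \<le> 2 powr p * Q / K"
    unfolding T_def K_def Q_def using k_int kt_int ktp_int k_nonneg p \<open>0 < K\<close>
    by (intro weighted_mean_powr_le) (auto simp: K_def)
  also have "\<dots> \<le> 2 powr p * Q / L"
    using \<open>0 \<le> Q\<close> L \<open>L \<le> K\<close> by (intro divide_left_mono) auto
  finally have TK: "(T / K) powr p \<le> 2 powr p * Q / L" .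
  have SK: "(S / \<delta> powr D / K) powr p \<le> (S / \<delta> powr D / L) powr p"
    using \<open>0 \<le> S\<close> L \<open>L \<le> K\<close> p \<delta> by (intro powr_mono2 divide_left_mono) auto
  have "0 \<le> T" unfolding T_def by (simp add: k_nonneg)
  have "norm (f x) powr p \<le> (T / K + S / \<delta> powr D / K) powr p"
    using fx p by (intro powr_mono2) auto
  also have "\<dots> \<le> 2 powr p * ((T / K) powr p + (S / \<delta> powr D / K) powr p)"
    using \<open>0 \<le> T\<close> \<open>0 \<le> S\<close> \<open>0 < K\<close> p by (intro add_powr_le) auto
  also have "\<dots> \<le> 2 powr p * (2 powr p * Q / L + (S / \<delta> powr D / L) powr p)"
    using TK SK by (intro mult_left_mono add_mono) auto
  also have "\<dots> = 2 powr p * 2 powr p / L * Q + (2 * (S / \<delta> powr D / L)) powr p"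
  proof -
    have "(2 * x) powr p = 2 powr p * x powr p" if "0 \<le> x" for x :: real
      using that by (simp add: powr_mult)
    from this[of "S / \<delta> powr D / L"] show ?thesis
      using \<open>0 \<le> S\<close> L by (simp add: distrib_left mult.assoc)
  qed
  also have "2 * (S / \<delta> powr D / L) = 2 / (\<delta> powr D * L) * S" by simp
  finally have "ennreal (norm (f x) powr p) \<le>
      ennreal (2 powr p * 2 powr p / L * Q + (2 / (\<delta> powr D * L) * S) powr p)"
    by (rule ennreal_leI)
  also have "\<dots> = ennreal (2 powr p * 2 powr p / L) * ennreal Q +
      ennreal ((2 / (\<delta> powr D * L) * S) powr p)"
    using \<open>0 \<le> Q\<close> L by (simp add: ennreal_plus flip: ennreal_mult)
  also have "\<dots> \<le> ennreal (2 powr p * 2 powr p / L) * I +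
      ennreal ((2 / (\<delta> powr D * L) * S) powr p)"
    by (intro add_right_mono mult_left_mono Q_le) simp
  finally show ?thesis by (simp add: I_def S_def)
qed

text \<open>As in Ehrling's lemma, a small multiple of the strong term and finitely many functionals
  control the norm. The pointwise bound is integrated over \<open>x\<close>; its energy coefficient
  is inversely proportional to the kernel mass \<open>L\<close>, which \<open>div\<close> lets be
  any prescribed number.\<close>

lemma log_energy_Ehrling:
  assumes p: "1 \<le> p" and D: "0 \<le> D" and e: "0 < e"
    and div: "\<And>L. \<exists>\<delta>>0. \<forall>x\<in>Z. ennreal L \<le> (\<integral>\<^sup>+ y. ennreal (1 / (d x y + 2 * \<delta>) powr D) \<partial>\<nu>)"
  shows "\<exists>(N::nat) A C. 0 \<le> C \<and> (\<forall>j<N. A j \<in> sets \<nu>) \<and>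
    (\<forall>f::'a \<Rightarrow> 'k::{real_normed_field, euclidean_space}. f \<in> Lp_space \<nu> p \<longrightarrow>
      (\<integral>\<^sup>+ x. ennreal (norm (f x) powr p) \<partial>\<nu>) \<le> ennreal e * log_energy d \<nu> D p f +
        ennreal (C * (\<Sum>j<N. norm (LINT y:A j|\<nu>. f y)) powr p))"
proof -
  \<comment> \<open>The mass for which the energy coefficient of the pointwise bound is exactly
    \<open>e\<close>.\<close>
  define L where "L = 2 powr p * 2 powr p / e"
  have L: "0 < L" and eq: "2 powr p * 2 powr p / L = e" using e by (auto simp: L_def)
  obtain \<delta> where \<delta>: "0 < \<delta>"
    "\<And>x. x \<in> Z \<Longrightarrow> ennreal L \<le> (\<integral>\<^sup>+ y. ennreal (1 / (d x y + 2 * \<delta>) powr D) \<partial>\<nu>)"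
    using div by blast
  obtain N :: nat and z A where A: "\<And>j. j < N \<Longrightarrow> z j \<in> Z" "\<And>j. j < N \<Longrightarrow> A j \<in> sets \<nu>"
    "disjoint_family_on A {..<N}" "(\<Union>j<N. A j) = Z" "\<And>j y. y \<in> A j \<Longrightarrow> d (z j) y < \<delta>"
    using small_partition[OF \<delta>(1)] by metis
  define q where "q = 2 / (\<delta> powr D * L)"
  have "0 \<le> q" using L by (simp add: q_def)
  define C where "C = q powr p * measure \<nu> Z"
  have "(\<integral>\<^sup>+ x. ennreal (norm (f x) powr p) \<partial>\<nu>) \<le> ennreal e * log_energy d \<nu> D p f +
        ennreal (C * (\<Sum>j<N. norm (LINT y:A j|\<nu>. f y)) powr p)"
    if f: "f \<in> Lp_space \<nu> p" for f :: "'a \<Rightarrow> 'k"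
  proof -
    let ?S = "\<Sum>j<N. norm (LINT y:A j|\<nu>. f y)"
    have "0 \<le> ?S" by (simp add: sum_nonneg)
    have [measurable]: "f \<in> borel_measurable \<nu>" using f by (simp add: Lp_space_def)
    have "(\<integral>\<^sup>+ x. ennreal (norm (f x) powr p) \<partial>\<nu>) \<le>
        (\<integral>\<^sup>+ x. ennreal e * (\<integral>\<^sup>+ y. ennreal (norm (f x - f y) powr p / d x y powr D) \<partial>\<nu>) +
          ennreal ((q * ?S) powr p) \<partial>\<nu>)"
      using norm_powr_le_energy_density[OF _ f p D \<delta>(1) L \<delta>(2) A]
      by (intro nn_integral_mono) (auto simp: space_borel eq q_def)
    also have "\<dots> = ennreal e * log_energy d \<nu> D p f +
        ennreal ((q * ?S) powr p) * emeasure \<nu> (space \<nu>)"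
      unfolding log_energy_def by (subst nn_integral_add) (simp_all add: nn_integral_cmult)
    also have "ennreal ((q * ?S) powr p) * emeasure \<nu> (space \<nu>) =
        ennreal (C * ?S powr p)"
      using \<open>0 \<le> ?S\<close> \<open>0 \<le> q\<close> by (simp add: emeasure_eq_measure space_borel C_def powr_mult ac_simps flip: ennreal_mult)
    finally show ?thesis .
  qed
  then show ?thesis using A(2) by (intro exI[of _ N] exI[of _ A] exI[of _ C]) (auto simp: C_def)
qed

text \<open>Along a subsequence for which all integrals over the sets \<open>A k j\<close> converge,
  the inequality applied to differences has a vanishing second term and a first term of at most
  \<open>e k\<close> times a fixed bound, so the subsequence is Cauchy in L^p. With the inequality
  as a hypothesis, a null measure is covered as well.\<close>

lemma compact_embedding_if_Ehrling:
  assumes p: "1 < p"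
    and ehrling: "\<And>e. 0 < e \<Longrightarrow> \<exists>(N::nat) A C. 0 \<le> C \<and> (\<forall>j<N. A j \<in> sets \<nu>) \<and>
      (\<forall>f::'a \<Rightarrow> 'k::{real_normed_field, euclidean_space}. f \<in> Lp_space \<nu> p \<longrightarrow>
        (\<integral>\<^sup>+ x. ennreal (norm (f x) powr p) \<partial>\<nu>) \<le> ennreal e * log_energy d \<nu> D p f +
          ennreal (C * (\<Sum>j<N. norm (LINT y:A j|\<nu>. f y)) powr p))"
  shows "compact_operator
    (Wlog_space d \<nu> D p :: ('a \<Rightarrow> 'k) set) (Wlog_norm d \<nu> D p) (Lp_space \<nu> p) (Lp_norm \<nu> p) (\<lambda>\<phi>. \<phi>)"
proof -
  have p1: "1 \<le> p" "0 \<le> p" using p by auto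
  have "\<exists>g\<in>Lp_space \<nu> p. \<exists>r. strict_mono r \<and> (\<lambda>n. Lp_norm \<nu> p (\<lambda>y. u (r n) y - g y)) \<longlonglongrightarrow> 0"
    if u: "\<And>n. u n \<in> Wlog_space d \<nu> D p" and bound: "\<And>n. Wlog_norm d \<nu> D p (u n) \<le> B"
    for u :: "nat \<Rightarrow> 'a \<Rightarrow> 'k" and B
  proof -
    have Lp: "u n \<in> Lp_space \<nu> p" for n using u[of n] by (simp add: Wlog_space_def)
    have meas [measurable]: "u n \<in> borel_measurable \<nu>" for n using Lp[of n] by (simp add: Lp_space_def)
    have Lp_diff: "(\<lambda>x. u m x - u n x) \<in> Lp_space \<nu> p" for m n
      by (rule Lp_space_diff[OF Lp Lp p1(2)])
    define b where "b = B powr p"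
    have b: "(\<integral>x. norm (u n x) powr p \<partial>\<nu>) \<le> b" "log_energy d \<nu> D p (u n) \<le> ennreal b" for n
    proof -
      define s where "s = (\<integral>x. norm (u n x) powr p \<partial>\<nu>)"
      define t where "t = enn2real (log_energy d \<nu> D p (u n))"
      have st: "0 \<le> s" "0 \<le> t" by (simp_all add: s_def t_def)
      have "(s + t) powr (1 / p) \<le> B"
        using bound[of n] st p by (simp add: Wlog_norm_def Lp_norm_def s_def t_def powr_powr)
      then have "((s + t) powr (1 / p)) powr p \<le> b"
        unfolding b_def using p by (intro powr_mono2) auto
      then have "s \<le> b" "t \<le> b" using st p by (simp_all add: powr_powr)
      moreover have "log_energy d \<nu> D p (u n) = ennreal t"
        using u[of n] by (simp add: t_def Wlog_space_def less_top)
      ultimately show "(\<integral>x. norm (u n x) powr p \<partial>\<nu>) \<le> b" "log_energy d \<nu> D p (u n) \<le> ennreal b"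
        using st by (auto simp: s_def ennreal_leI)
    qed
    have "0 \<le> b" by (simp add: b_def)
    \<comment> \<open>A sequence tending to 0 keeps the number of functionals countable, as the
      diagonal argument requires.\<close>
    define e where "e k = 1 / real (Suc k)" for k
    have "\<forall>k. \<exists>(N::nat) A C. 0 \<le> C \<and> (\<forall>j<N. A j \<in> sets \<nu>) \<and>
      (\<forall>f::'a \<Rightarrow> 'k. f \<in> Lp_space \<nu> p \<longrightarrow>
        (\<integral>\<^sup>+ x. ennreal (norm (f x) powr p) \<partial>\<nu>) \<le> ennreal (e k) * log_energy d \<nu> D p f +
          ennreal (C * (\<Sum>j<N. norm (LINT y:A j|\<nu>. f y)) powr p))"
      by (intro allI ehrling) (simp add: e_def)
    then obtain N :: "nat \<Rightarrow> nat" and A C where C: "\<And>k. 0 \<le> C k"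
      and A: "\<And>k j. j < N k \<Longrightarrow> A k j \<in> sets \<nu>"
      and ineq: "\<And>k (f::'a \<Rightarrow> 'k). f \<in> Lp_space \<nu> p \<Longrightarrow>
        (\<integral>\<^sup>+ x. ennreal (norm (f x) powr p) \<partial>\<nu>) \<le> ennreal (e k) * log_energy d \<nu> D p f +
          ennreal (C k * (\<Sum>j<N k. norm (LINT y:A k j|\<nu>. f y)) powr p)"
      by metis
    have int: "integrable \<nu> (u n)" for n by (rule Lp_space_imp_integrable[OF Lp p1(1)])
    define I where "I = (SIGMA k:UNIV. {..<N k})"
    define a where "a i n = (LINT y:A (fst i) (snd i)|\<nu>. u n y)" for i n
    have "bounded (range (a i))" if "i \<in> I" for i
    proof -
      have Ai: "A (fst i) (snd i) \<in> sets \<nu>" using that A by (auto simp: I_def)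
      have "norm (a i n) \<le> measure \<nu> (space \<nu>) + b" for n
      proof -
        have "norm (a i n) \<le> (\<integral>y. norm (indicator (A (fst i) (snd i)) y *\<^sub>R u n y) \<partial>\<nu>)"
          unfolding a_def set_lebesgue_integral_def by (rule integral_norm_bound)
        also have "\<dots> \<le> (\<integral>y. norm (u n y) \<partial>\<nu>)"
          using int integrable_mult_indicator[OF Ai int]
          by (intro integral_mono integrable_norm) (auto simp: indicator_def)
        also have "\<dots> \<le> 1 * measure \<nu> (space \<nu>) + 1 powr (1 - p) * (\<integral>y. norm (u n y) powr p \<partial>\<nu>)"
          by (rule integral_norm_le[OF Lp p1(1)]) simp
        finally show ?thesis using b(1)[of n] by simp
      qed
      then show ?thesis by (auto intro!: boundedI)
    qed
    then obtain r where r: "strict_mono r" "\<And>i. i \<in> I \<Longrightarrow> convergent (\<lambda>n. a i (r n))"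
      using convergent_diagonal_subseq[of I a] by (auto simp: I_def)
    have "\<exists>n0. \<forall>m\<ge>n0. \<forall>n\<ge>n0. (\<integral>x. norm (u (r m) x - u (r n) x) powr p \<partial>\<nu>) < \<epsilon>" if \<epsilon>: "0 < \<epsilon>" for \<epsilon>
    proof -
      \<comment> \<open>Bounds the energy of every difference, by \<open>log_energy_lincomb\<close>
        with coefficients 1 and -1.\<close>
      define M where "M = 2 powr p * b + 2 powr p * b"
      have "0 \<le> M" using \<open>0 \<le> b\<close> by (simp add: M_def)
      have energy: "log_energy d \<nu> D p (\<lambda>x. u m x - u n x) \<le> ennreal M" for m n
      proof -
        have "log_energy d \<nu> D p (\<lambda>x. u m x - u n x) \<le>
            ennreal (2 powr p) * log_energy d \<nu> D p (u m) + ennreal (2 powr p) * log_energy d \<nu> D p (u n)"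
          using log_energy_lincomb[OF meas meas p1(2), of D 1 m "-1" n] by simp
        also have "\<dots> \<le> ennreal (2 powr p) * ennreal b + ennreal (2 powr p) * ennreal b"
          by (intro add_mono mult_left_mono b) auto
        also have "\<dots> = ennreal M"
          using \<open>0 \<le> b\<close> by (simp add: M_def flip: ennreal_mult ennreal_plus)
        finally show ?thesis .
      qed
      \<comment> \<open>\<open>M + 1\<close> avoids a division by 0, as does \<open>C k + 1\<close>
        below.\<close>
      obtain k where k: "1 / real (Suc k) < \<epsilon> / (2 * (M + 1))"
        using nat_approx_posE[of "\<epsilon> / (2 * (M + 1))"] \<epsilon> \<open>0 \<le> M\<close> by (auto simp: add_nonneg_pos)
      have "e k * M \<le> e k * (M + 1)" by (intro mult_left_mono) (auto simp: e_def)
      also have "\<dots> < \<epsilon> / (2 * (M + 1)) * (M + 1)"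
        using k \<open>0 \<le> M\<close> unfolding e_def by (intro mult_strict_right_mono) auto
      also have "\<dots> = \<epsilon> / 2" using \<open>0 \<le> M\<close> by (simp add: divide_simps)
      finally have eM: "e k * M < \<epsilon> / 2" .
      define l where "l j = lim (\<lambda>n. a (k, j) (r n))" for j
      define s where "s n = (\<Sum>j<N k. norm (a (k, j) (r n) - l j))" for n
      have "(\<lambda>n. a (k, j) (r n)) \<longlonglongrightarrow> l j" if "j < N k" for j
        unfolding l_def using r(2)[of "(k, j)"] that by (simp add: I_def convergent_LIMSEQ_iff)
      then have "s \<longlonglongrightarrow> (\<Sum>j<N k. norm (l j - l j))"
        unfolding s_def by (intro tendsto_intros) auto
      then have s: "s \<longlonglongrightarrow> 0" by simp
      have C1: "0 < C k + 1" using C[of k] by simp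
      define q where "q = \<epsilon> / (2 * (C k + 1))"
      have q: "0 < q" using \<epsilon> C1 by (simp add: q_def)
      \<comment> \<open>As \<open>h powr p = q\<close>, a sum of integrals of at most
        \<open>h\<close> contributes at most \<open>C k * q\<close>, which is less than
        \<open>\<epsilon> / 2\<close>.\<close>
      define h where "h = q powr (1 / p)"
      have h: "0 < h" "h powr p = q"
        using q p by (simp_all add: h_def powr_powr)
      have "C k * h powr p < (C k + 1) * h powr p" using h by (intro mult_strict_right_mono) auto
      also have "\<dots> = \<epsilon> / 2" using C1 by (simp add: h(2) q_def divide_simps)
      finally have Ch: "C k * h powr p < \<epsilon> / 2" .
      obtain n0 where "\<And>n. n \<ge> n0 \<Longrightarrow> \<bar>s n\<bar> < h / 2"
        using LIMSEQ_D[OF s, of "h / 2"] h by auto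
      then have n0: "s n < h / 2" if "n \<ge> n0" for n
        using that by (meson abs_ge_self le_less_trans)
      have "(\<integral>x. norm (u (r m) x - u (r n) x) powr p \<partial>\<nu>) < \<epsilon>" if mn: "m \<ge> n0" "n \<ge> n0" for m n
      proof -
        let ?S = "\<Sum>j<N k. norm (LINT y:A k j|\<nu>. u (r m) y - u (r n) y)"
        have "?S = (\<Sum>j<N k. norm (a (k, j) (r m) - a (k, j) (r n)))"
        proof (intro sum.cong refl arg_cong[where f = norm])
          fix j assume "j \<in> {..<N k}"
          then have "set_integrable \<nu> (A k j) (u n)" for n
            unfolding set_integrable_def using A int by (intro integrable_mult_indicator) auto
          then show "(LINT y:A k j|\<nu>. u (r m) y - u (r n) y) = a (k, j) (r m) - a (k, j) (r n)"
            by (simp add: a_def set_integral_diff)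
        qed
        also have "\<dots> \<le> (\<Sum>j<N k. norm (a (k, j) (r m) - l j) + norm (a (k, j) (r n) - l j))"
        proof (rule sum_mono)
          fix j show "norm (a (k, j) (r m) - a (k, j) (r n))
              \<le> norm (a (k, j) (r m) - l j) + norm (a (k, j) (r n) - l j)"
            using norm_triangle_ineq4[of "a (k, j) (r m) - l j" "a (k, j) (r n) - l j"] by simp
        qed
        also have "\<dots> = s m + s n" by (simp add: s_def sum.distrib)
        also have "\<dots> \<le> h" using n0[OF mn(1)] n0[OF mn(2)] by simp
        finally have "?S powr p \<le> h powr p" using p by (intro powr_mono2) (auto simp: sum_nonneg)
        then have CS: "C k * ?S powr p \<le> C k * h powr p" using C by (rule mult_left_mono)
        have "ennreal (\<integral>x. norm (u (r m) x - u (r n) x) powr p \<partial>\<nu>) =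
            (\<integral>\<^sup>+ x. ennreal (norm (u (r m) x - u (r n) x) powr p) \<partial>\<nu>)"
          by (rule nn_integral_norm_powr[OF Lp_diff, symmetric])
        also have "\<dots> \<le> ennreal (e k) * log_energy d \<nu> D p (\<lambda>x. u (r m) x - u (r n) x) +
            ennreal (C k * ?S powr p)"
          by (rule ineq[OF Lp_diff])
        also have "\<dots> \<le> ennreal (e k) * ennreal M + ennreal (C k * h powr p)"
          by (rule add_mono[OF mult_left_mono[OF energy] ennreal_leI[OF CS]]) simp
        also have "\<dots> = ennreal (e k * M + C k * h powr p)"
          using \<open>0 \<le> M\<close> C by (simp add: e_def flip: ennreal_mult ennreal_plus)
        finally have "(\<integral>x. norm (u (r m) x - u (r n) x) powr p \<partial>\<nu>) \<le> e k * M + C k * h powr p"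
          using \<open>0 \<le> M\<close> C by (subst (asm) ennreal_le_iff) (auto simp: e_def)
        then show ?thesis using eM Ch by simp
      qed
      then show ?thesis by blast
    qed
    then obtain g where g: "g \<in> Lp_space \<nu> p"
        "(\<lambda>n. \<integral>x. norm (u (r n) x - g x) powr p \<partial>\<nu>) \<longlonglongrightarrow> 0"
      using Lp_complete[of "\<lambda>n. u (r n)" p] Lp p1(1) by blast
    have "(\<lambda>n. Lp_norm \<nu> p (\<lambda>y. u (r n) y - g y)) \<longlonglongrightarrow> 0 powr (1 / p)"
      unfolding Lp_norm_def using g(2) p by (intro tendsto_powr' tendsto_const) auto
    then show ?thesis using g(1) r(1) by auto
  qed
  note subseq = this
  show ?thesis
    unfolding compact_operator_def
  proof (intro conjI ballI allI impI)
    show "(\<lambda>\<phi>. \<phi>) \<in> Wlog_space d \<nu> D p \<rightarrow> Lp_space \<nu> p" by (auto simp: Wlog_space_def)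
  qed (use subseq in \<open>auto intro: Wlog_space_lincomb[OF _ _ p1(2)] simp: Lp_norm_def\<close>)
qed

end

end

section \<open>Ahlfors regular spaces\<close>

text \<open>The upper bound at radius 0 makes points null. For \<open>D = 0\<close> all balls of
  positive radius up to the diameter would have mass at least \<open>1 / C\<close>, against
  continuity from above. The divergence of the kernel requires a positive exponent.\<close>

lemma (in metric_measure) ahlfors_exponent_nonzero:
  assumes "ahlfors_regular Z d \<nu> D" "\<xi> \<in> Z" "0 < set_diam d Z"
  shows "D \<noteq> 0"
proof
  assume D: "D = 0"
  let ?\<Delta> = "set_diam d Z"
  obtain C where C: "1 \<le> C" and reg: "\<And>r. 0 \<le> r \<Longrightarrow> r \<le> ?\<Delta> \<Longrightarrow>
      ennreal (r powr D / C) \<le> emeasure \<nu> {\<eta> \<in> Z. d \<xi> \<eta> \<le> r} \<and>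
      emeasure \<nu> {\<eta> \<in> Z. d \<xi> \<eta> \<le> r} \<le> ennreal (C * r powr D)"
    using assms(1,2) unfolding ahlfors_regular_def by blast
  define B where "B n = {\<eta> \<in> Z. d \<xi> \<eta> \<le> ?\<Delta> / real (Suc n)}" for n
  have "(\<lambda>n. emeasure \<nu> (B n)) \<longlonglongrightarrow> emeasure \<nu> (\<Inter>n. B n)"
  proof (rule Lim_emeasure_decseq)
    show "range B \<subseteq> sets \<nu>" using cball_measurable[OF assms(2)] by (auto simp: B_def)
    have "?\<Delta> / real (Suc n) \<le> ?\<Delta> / real (Suc m)" if "m \<le> n" for m n
      using assms(3) that by (intro divide_left_mono) auto
    then show "decseq B" unfolding B_def decseq_def by fastforce
  qed simp
  moreover have "(\<Inter>n. B n) = {\<eta> \<in> Z. d \<xi> \<eta> \<le> 0}"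
  proof -
    have "(\<lambda>n. ?\<Delta> / real (Suc n)) \<longlonglongrightarrow> 0"
      using LIMSEQ_Suc[OF lim_const_over_n[of ?\<Delta>]] by simp
    then have "d \<xi> \<eta> \<le> 0" if "\<And>n. d \<xi> \<eta> \<le> ?\<Delta> / real (Suc n)" for \<eta>
      using that by (intro LIMSEQ_le_const) auto
    moreover have "d \<xi> \<eta> \<le> ?\<Delta> / real (Suc n)" if "d \<xi> \<eta> \<le> 0" for \<eta> n
      using that assms(3) by (intro order_trans[OF that]) auto
    ultimately show ?thesis unfolding B_def by blast
  qed
  moreover have "emeasure \<nu> {\<eta> \<in> Z. d \<xi> \<eta> \<le> 0} = 0"
    \<comment> \<open>This uses the convention \<open>0 powr 0 = 0\<close>.\<close>
    using reg[of 0] assms(3) by simp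
  ultimately have "(\<lambda>n. emeasure \<nu> (B n)) \<longlonglongrightarrow> 0" by simp
  moreover have "ennreal (1 / C) \<le> emeasure \<nu> (B n)" for n
  proof -
    have "0 < ?\<Delta> / real (Suc n)" "?\<Delta> / real (Suc n) \<le> ?\<Delta>"
      using assms(3) by (auto simp: field_simps)
    then show ?thesis using reg[of "?\<Delta> / real (Suc n)"] D by (simp add: B_def)
  qed
  ultimately have "ennreal (1 / C) \<le> 0" by (intro LIMSEQ_le_const) auto
  then show False using C by simp
qed

lemma hausdorff_dimension_nonneg: "0 \<le> hausdorff_dimension Z d"
  unfolding hausdorff_dimension_def by (rule Inf_greatest) auto

text \<open>\<open>measure_of\<close> takes its sigma-algebra from the generators alone, whatever
  set function is supplied.\<close>

lemma sets_hausdorff_measure: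
  assumes "Metric_space Z d"
  shows "sets (hausdorff_measure Z d s) = sigma_sets Z {U. openin (Metric_space.mtopology Z d) U}"
proof -
  interpret Metric_space Z d by (rule assms)
  have "{U. openin mtopology U} \<subseteq> Pow Z" using openin_subset by fastforce
  then show ?thesis unfolding hausdorff_measure_def by (rule sets_measure_of)
qed

lemma space_hausdorff_measure:
  assumes "Metric_space Z d"
  shows "space (hausdorff_measure Z d s) = Z"
proof -
  interpret Metric_space Z d by (rule assms)
  have "{U. openin mtopology U} \<subseteq> Pow Z" using openin_subset by fastforce
  then show ?thesis unfolding hausdorff_measure_def by (rule space_measure_of)
qed

section \<open>Application to the boundary of a strongly hyperbolic space\<close>

theorem proposition1p5:
  fixes G :: "('g, 'm) monoid_scheme"
    and act :: "'g \<Rightarrow> 'x \<Rightarrow> 'x::metric_space"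
    and x0 :: 'x
    and \<epsilon> D p :: real
    and Z :: "(nat \<Rightarrow> 'x) set set"
    and d :: "(nat \<Rightarrow> 'x) set \<Rightarrow> (nat \<Rightarrow> 'x) set \<Rightarrow> real"
    and \<nu> :: "(nat \<Rightarrow> 'x) set measure"
  assumes "hyperbolic_group G" and "\<not> elementary_group G"
    and "roughly_geodesic (UNIV :: 'x set) dist"
    and "strongly_hyperbolic (UNIV :: 'x set) dist \<epsilon>"
    and "group_action G (UNIV :: 'x set) act"
    and "isometric_action G act" and "proper_action G act" and "cocompact_action G act"
    and "Z = gromov_boundary x0"
    and "d = boundary_dist \<epsilon> x0"
    and "hausdorff_dimension Z d = ereal D"
    and "\<nu> = hausdorff_measure Z d D"
    and "ahlfors_regular Z d \<nu> D"
    and "1 < p"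
  shows "compact_operator
           (Wlog_space d \<nu> D p :: ((nat \<Rightarrow> 'x) set \<Rightarrow> 'k::{real_normed_field, euclidean_space}) set)
           (Wlog_norm d \<nu> D p)
           (Lp_space \<nu> p) (Lp_norm \<nu> p)
           (\<lambda>\<phi>. \<phi>)"
proof -
  note hyp = assms(4) and Z = assms(9) and d = assms(10) and \<nu> = assms(12) and reg = assms(13)
  have metric: "Metric_space Z d" unfolding Z d by (rule Metric_space_boundary[OF hyp])
  interpret Metric_space Z d by (rule metric)
  have space: "space \<nu> = Z" unfolding \<nu> by (rule space_hausdorff_measure[OF metric])
  have sets: "sets \<nu> = sigma_sets Z {U. openin mtopology U}"
    unfolding \<nu> by (rule sets_hausdorff_measure[OF metric])
  define \<Delta> where "\<Delta> = set_diam d Z"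
  have d_le: "d \<xi> \<eta> \<le> \<Delta>" if "\<xi> \<in> Z" "\<eta> \<in> Z" for \<xi> \<eta>
  proof -
    have "bdd_above ((\<lambda>(x, y). d x y) ` (Z \<times> Z))"
      by (rule bdd_aboveI2[of _ _ 1]) (auto simp: Z d boundary_dist_le_1[OF hyp])
    then show ?thesis
      unfolding \<Delta>_def set_diam_def using that
      by (intro cSUP_upper2[of "\<lambda>(x, y). d x y" "Z \<times> Z" "(\<xi>, \<eta>)"]) auto
  qed
  obtain C where C: "1 \<le> C" and ball: "\<And>\<xi> r. \<xi> \<in> Z \<Longrightarrow> 0 \<le> r \<Longrightarrow> r \<le> \<Delta> \<Longrightarrow>
      ennreal (r powr D / C) \<le> emeasure \<nu> {\<eta> \<in> Z. d \<xi> \<eta> \<le> r} \<and>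
      emeasure \<nu> {\<eta> \<in> Z. d \<xi> \<eta> \<le> r} \<le> ennreal (C * r powr D)"
    using reg unfolding ahlfors_regular_def \<Delta>_def by blast
  \<comment> \<open>The whole boundary is a closed ball of radius \<Delta> around any of its points,
    so the upper regularity bound applies to it.\<close>
  have emeasure_Z: "emeasure \<nu> Z \<le> ennreal (C * \<Delta> powr D)" if \<xi>: "\<xi> \<in> Z" for \<xi>
  proof -
    have "{\<eta> \<in> Z. d \<xi> \<eta> \<le> \<Delta>} = Z" using d_le[OF \<xi>] by auto
    then show ?thesis using ball[OF \<xi>, of \<Delta>] d_le[OF \<xi> \<xi>] \<xi> by simp
  qed
  have "emeasure \<nu> Z < \<infinity>"
  proof (cases "Z = {}")
    case False
    then obtain \<xi> where "\<xi> \<in> Z" by blast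
    from emeasure_Z[OF this] show ?thesis by (rule le_less_trans) simp
  qed simp
  then interpret finite_measure \<nu> by (intro finite_measureI) (simp add: space)
  interpret metric_measure Z d \<nu> by unfold_locales (rule sets)
  have p: "1 \<le> p" using assms(14) by simp
  have "0 \<le> D" using hausdorff_dimension_nonneg[of Z d] assms(11) by simp
  show ?thesis
  \<comment> \<open>The lower mass bounds are useful only over a positive range of radii.
    Nonemptiness is listed because \<open>set_diam\<close> of the empty set is an unspecified
    real.\<close>
  proof (cases "Z \<noteq> {} \<and> 0 < \<Delta>")
    case True
    then obtain \<xi> where "\<xi> \<in> Z" "0 < \<Delta>" by blast
    then have "D \<noteq> 0" using ahlfors_exponent_nonzero[OF reg] by (simp add: \<Delta>_def)
    then have D: "0 < D" using \<open>0 \<le> D\<close> by simp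
    have c: "0 < 1 / C" using C by simp
    have lower: "ennreal (1 / C * r powr D) \<le> emeasure \<nu> {\<eta> \<in> Z. d \<xi> \<eta> \<le> r}"
      if "\<xi> \<in> Z" "0 \<le> r" "r \<le> \<Delta>" for \<xi> r
      using ball[OF that] by simp
    have tot: "mtotally_bounded Z"
      by (rule mtotally_bounded_if_lower_regular[OF \<open>0 < \<Delta>\<close> c lower])
    show ?thesis
    proof (rule compact_embedding_if_Ehrling[OF tot assms(14)], rule log_energy_Ehrling[OF tot p \<open>0 \<le> D\<close>])
      show "\<exists>\<delta>>0. \<forall>\<xi>\<in>Z. ennreal L \<le> (\<integral>\<^sup>+ \<eta>. ennreal (1 / (d \<xi> \<eta> + 2 * \<delta>) powr D) \<partial>\<nu>)" for L
        by (rule log_kernel_diverges[OF \<open>0 < \<Delta>\<close> c D lower])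
    qed
  next
    case False
    then have unique: "\<xi> = \<eta>" if "\<xi> \<in> Z" "\<eta> \<in> Z" for \<xi> \<eta>
      using d_le[OF that] that zero[OF that] nonneg[of \<xi> \<eta>] by (auto simp del: nonneg zero)
    have "finite Z"
    proof (cases "Z = {}")
      case False
      then obtain \<xi> where "\<xi> \<in> Z" by blast
      then have "Z \<subseteq> {\<xi>}" using unique by blast
      then show ?thesis by (rule finite_subset) simp
    qed simp
    then have tot: "mtotally_bounded Z" by (intro finite_imp_mtotally_bounded) auto
    \<comment> \<open>A one-point boundary is a ball of radius \<Delta> = 0, of mass at most
      \<open>C * 0 powr D = 0\<close>.\<close>
    have "emeasure \<nu> (space \<nu>) = 0"
    proof (cases "Z = {}")
      case False
      then obtain \<xi> where \<xi>: "\<xi> \<in> Z" by blast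
      have "\<Delta> = 0" using d_le[OF \<xi> \<xi>] \<xi> \<open>\<not> (Z \<noteq> {} \<and> 0 < \<Delta>)\<close> by auto
      then show ?thesis using emeasure_Z[OF \<xi>] by (simp add: space)
    qed (simp add: space)
    then have "AE x in \<nu>. False" by (intro AE_I[of _ _ "space \<nu>"]) auto
    then have null: "(\<integral>\<^sup>+ x. g x \<partial>\<nu>) = 0" for g :: "(nat \<Rightarrow> 'x) set \<Rightarrow> ennreal"
      by (subst nn_integral_cong_AE[of g "\<lambda>x. 0"]) auto
    \<comment> \<open>All integrals vanish, so the Ehrling inequality holds with no sets and
      constant 0.\<close>
    show ?thesis
      by (rule compact_embedding_if_Ehrling[OF tot assms(14)])
         (auto simp: null intro!: exI[of _ 0])
  qed
qed

end
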